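(* Let $M$ be a Riemannian manifold with operators $\bar\Delta$ (on functions and on 1-forms) and associated tensor $\mathrm{Ricci}_{\bar\Delta}$ as described in the context, let $K:\bar\Omega^1\to\bar\Omega^1$ be a classical tensor ($C(M)$-linear map), and let $\nabla$ be the left connection on $\Omega^1$ with \[\nabla\omega=\phi(\bar\nabla\omega)+\tfrac\lambda2\theta'\hat\otimes(\bar\Delta-K)\omega,\qquad\forall\omega\in\bar\Omega^1\subset\Omega^1,\] and with some value $\nabla\theta'\in\Omega^1\hat\otimes\Omega^1$. Suppose that $[\nabla\theta',f]=0$ for all functions $f\in C(M)$. Then \[\sigma(\omega\hat\otimes\eta)=\eta\hat\otimes\omega+\lambda\bar\nabla_\omega\eta\hat\otimes\theta'-\lambda\theta'\hat\otimes\bar\nabla_\eta\omega+\lambda(\omega,\eta)\nabla\theta'+\tfrac{\lambda^2}2(\mathrm{Ricci}_{\bar\Delta}+K^T)(\omega,\eta)\,\theta'\hat\otimes\theta',\] \[\sigma(\theta'\hat\otimes\omega)=\omega\hat\otimes\theta',\quad\sigma(\omega\hat\otimes\theta')=\theta'\hat\otimes\omega,\quad\sigma(\theta'\hat\otimes\theta')=\theta'\hat\otimes\theta'\] for all $\omega,\eta\in\bar\Omega^1$ makes $\nabla$ into a bimodule connection.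
   Context: $C(M)$: smooth functions; $\bar\Omega^1$: classical 1-forms; $\bar{\mathrm d}$: classical exterior derivative; $(\ ,\ )$: inverse metric on 1-forms (extended factorwise to tensor products); $\bar\nabla$: Levi-Civita connection; $\bar\nabla_\omega:=\bar\nabla_{\omega^*}$ where $\omega^*=(\omega,\ )$ is the vector field dual to $\omega$; $\bar\otimes$: classical tensor product over $C(M)$; $\lambda$: constant deformation parameter. $\bar\Delta$ denotes operators on functions and on 1-forms satisfying, for $f,g\in C(M)$, $\omega,\eta\in\bar\Omega^1$: $\bar\Delta(fg)=(\bar\Delta f)g+f\bar\Delta g+2(\bar{\mathrm d}f,\bar{\mathrm d}g)$; $\bar\Delta(f\omega)=(\bar\Delta f)\omega+f\bar\Delta\omega+2\bar\nabla_{\bar{\mathrm d}f}\omega$; $\bar\Delta((\omega,\eta))=(\bar\Delta\omega,\eta)+(\omega,\bar\Delta\eta)+2(\bar\nabla\omega,\bar\nabla\eta)$; and $[\bar\Delta,\bar{\mathrm d}]f=\mathrm{Ricci}_{\bar\Delta}(\bar{\mathrm d}f)$ for some $C(M)$-linear operator $\mathrm{Ricci}_{\bar\Delta}$ on $\bar\Omega^1$. (E.g. $\bar\Delta$ the Laplace-Beltrami operator and $\mathrm{Ricci}_{\bar\Delta}$ the Ricci tensor.) A tensorial operator $K$ on 1-forms is also viewed as a bilinear $K(\omega,\eta)=(\omega,K\eta)$; $K^T$ is the transpose, $K^T(\omega,\eta)=K(\eta,\omega)$. Noncommutative calculus: $\Omega^1=\bar\Omega^1\oplus C(M)\theta'$,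 a $C(M)$-bimodule with the usual left action, $\theta'$ central, and right action $\omega\bullet f=\omega f+\lambda(\omega,\bar{\mathrm d}f)\theta'$; $\mathrm df=\bar{\mathrm d}f+\frac\lambda2(\bar\Delta f)\theta'$. $\hat\otimes$ is the tensor product over $C(M)$ with respect to this bimodule structure. $\phi:\bar\Omega^1\bar\otimes\bar\Omega^1\to\Omega^1\hat\otimes\Omega^1$ is the well-defined left module map $\phi(\omega\bar\otimes\eta)=\omega\hat\otimes\eta-\lambda\theta'\hat\otimes\bar\nabla_\omega\eta$. A left connection is a linear map $\nabla:\Omega^1\to\Omega^1\hat\otimes\Omega^1$ with $\nabla(f\omega)=\mathrm df\hat\otimes\omega+f\nabla\omega$. It is a bimodule connection with generalised braiding $\sigma$ if $\sigma:\Omega^1\hat\otimes\Omega^1\to\Omega^1\hat\otimes\Omega^1$ is a well-defined bimodule map with $\nabla(\omega\bullet f)=(\nabla\omega)\bullet f+\sigma(\omega\hat\otimes\mathrm df)$ for all $\omega\in\Omega^1$, $f\in C(M)$. The commutator is $[X,f]=X\bullet f-f\bullet X$. *)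

theory Defs
  imports
    "HOL-Analysis.Analysis"
    "HOL-Library.Function_Algebras"
    "HOL-Library.Set_Algebras"
    "HOL-Library.Poly_Mapping"
begin

section \<open>Smooth manifolds and smooth functions\<close>

primrec Ck_on ::
  "nat \<Rightarrow> 'a::real_normed_vector set \<Rightarrow> ('a \<Rightarrow> 'b::real_normed_vector) \<Rightarrow> bool" where
  "Ck_on 0 S f \<longleftrightarrow> continuous_on S f"
| "Ck_on (Suc n) S f \<longleftrightarrow>
     (\<forall>x\<in>S. f differentiable (at x)) \<and> (\<forall>v. Ck_on n S (\<lambda>x. frechet_derivative f (at x) v))"

definition smooth_on ::
  "'a::real_normed_vector set \<Rightarrow> ('a \<Rightarrow> 'b::real_normed_vector) \<Rightarrow> bool" where
  "smooth_on S f \<longleftrightarrow> (\<forall>n. Ck_on n S f)"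

text \<open>
  The points of the manifold are all the elements of a Hausdorff, second countable type \<open>'m\<close>.
  A chart is a pair of its domain and its coordinate map into the model space \<open>'e\<close>.
\<close>

type_synonym ('m, 'e) chart = "'m set \<times> ('m \<Rightarrow> 'e)"

definition is_chart ::
  "('m::topological_space, 'e::euclidean_space) chart \<Rightarrow> bool" where
  "is_chart c \<longleftrightarrow> (case c of (U, \<phi>) \<Rightarrow>
     open U \<and> open (\<phi> ` U) \<and> homeomorphism U (\<phi> ` U) \<phi> (inv_into U \<phi>))"

definition smooth_atlas ::
  "('m::{second_countable_topology, t2_space}, 'e::euclidean_space) chart set \<Rightarrow> bool" where
  "smooth_atlas \<A> \<longleftrightarrow>
     (\<forall>c\<in>\<A>. is_chart c) \<and> (\<Union>c\<in>\<A>. fst c) = UNIV \<and>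
     (\<forall>(U, \<phi>)\<in>\<A>. \<forall>(V, \<psi>)\<in>\<A>. smooth_on (\<phi> ` (U \<inter> V)) (\<psi> \<circ> inv_into U \<phi>))"

text \<open>
  The scalars \<open>'k::real_normed_field\<close> are the real or the complex numbers (there are no other
  fields of this class up to isomorphism), so real-valued and complex-valued smooth functions
  are treated at once.  Sums and products of functions are pointwise.
\<close>

definition smooth_functions ::
  "('m::{second_countable_topology, t2_space}, 'e::euclidean_space) chart set
    \<Rightarrow> ('m \<Rightarrow> 'k::real_normed_field) set" where
  "smooth_functions \<A> = {f. \<forall>(U, \<phi>)\<in>\<A>. smooth_on (\<phi> ` U) (f \<circ> inv_into U \<phi>)}"


section \<open>Vector fields and 1-forms\<close>

text \<open>
  In the following, \<open>C\<close> is the algebra of smooth functions.  Vector fields are the derivations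
  of \<open>C\<close>, and 1-forms the \<open>C\<close>-linear maps from vector fields to \<open>C\<close>.  Both are extended by 0
  outside their domains, so that equality is equality of HOL functions.  If the scalars are
  complex, these are the complexified vector fields and 1-forms.
\<close>

type_synonym ('m, 'k) vfield = "('m \<Rightarrow> 'k) \<Rightarrow> ('m \<Rightarrow> 'k)"
type_synonym ('m, 'k) form = "('m, 'k) vfield \<Rightarrow> ('m \<Rightarrow> 'k)"

definition vector_fields :: "('m \<Rightarrow> 'k::real_normed_field) set \<Rightarrow> ('m, 'k) vfield set" where
  "vector_fields C = {X.
     (\<forall>f\<in>C. X f \<in> C) \<and> (\<forall>f. f \<notin> C \<longrightarrow> X f = 0) \<and>
     (\<forall>f\<in>C. \<forall>h\<in>C. X (f + h) = X f + X h) \<and>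
     (\<forall>c. \<forall>f\<in>C. X ((\<lambda>_. c) * f) = (\<lambda>_. c) * X f) \<and>
     (\<forall>f\<in>C. \<forall>h\<in>C. X (f * h) = X f * h + f * X h)}"

definition lie_bracket ::
  "('m, 'k::real_normed_field) vfield \<Rightarrow> ('m, 'k) vfield \<Rightarrow> ('m, 'k) vfield" where
  "lie_bracket X Y = (\<lambda>f. X (Y f) - Y (X f))"

definition vscale ::
  "('m \<Rightarrow> 'k::real_normed_field) \<Rightarrow> ('m, 'k) vfield \<Rightarrow> ('m, 'k) vfield" where
  "vscale f X = (\<lambda>h. f * X h)"

definition one_forms :: "('m \<Rightarrow> 'k::real_normed_field) set \<Rightarrow> ('m, 'k) form set" where
  "one_forms C = {\<omega>.
     (\<forall>X\<in>vector_fields C. \<omega> X \<in> C) \<and> (\<forall>X. X \<notin> vector_fields C \<longrightarrow> \<omega> X = 0) \<and>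
     (\<forall>X\<in>vector_fields C. \<forall>Y\<in>vector_fields C. \<omega> (X + Y) = \<omega> X + \<omega> Y) \<and>
     (\<forall>f\<in>C. \<forall>X\<in>vector_fields C. \<omega> (vscale f X) = f * \<omega> X)}"

definition fscale ::
  "('m \<Rightarrow> 'k::real_normed_field) \<Rightarrow> ('m, 'k) form \<Rightarrow> ('m, 'k) form" where
  "fscale f \<omega> = (\<lambda>X. f * \<omega> X)"

definition ext_d ::
  "('m \<Rightarrow> 'k::real_normed_field) set \<Rightarrow> ('m \<Rightarrow> 'k) \<Rightarrow> ('m, 'k) form" where
  "ext_d C f = (\<lambda>X. if X \<in> vector_fields C then X f else 0)"


section \<open>Riemannian metrics\<close>

definition real_field ::
  "('m \<Rightarrow> 'k::real_normed_field) set \<Rightarrow> ('m, 'k) vfield \<Rightarrow> bool" where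
  "real_field C X \<longleftrightarrow> X \<in> vector_fields C \<and> (\<forall>f\<in>C. range f \<subseteq> \<real> \<longrightarrow> range (X f) \<subseteq> \<real>)"

text \<open>
  A Riemannian metric as a \<open>C\<close>-bilinear map on vector fields.  The last conjunct is positive
  definiteness at every point: the tangent vector \<open>X\<^sub>p\<close> is nonzero iff \<open>(X f)(p) \<noteq> 0\<close> for some
  function \<open>f\<close>.  For complex scalars this describes the complex-bilinear extension of an
  ordinary Riemannian metric.
\<close>

definition riemannian_metric ::
  "('m \<Rightarrow> 'k::real_normed_field) set \<Rightarrow> (('m, 'k) vfield \<Rightarrow> ('m, 'k) vfield \<Rightarrow> ('m \<Rightarrow> 'k)) \<Rightarrow> bool"
  where
  "riemannian_metric C g \<longleftrightarrow>
     (\<forall>X\<in>vector_fields C. \<forall>Y\<in>vector_fields C. g X Y \<in> C \<and> g X Y = g Y X) \<and>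
     (\<forall>X\<in>vector_fields C. \<forall>Y\<in>vector_fields C. \<forall>Z\<in>vector_fields C.
        g (X + Y) Z = g X Z + g Y Z) \<and>
     (\<forall>f\<in>C. \<forall>X\<in>vector_fields C. \<forall>Y\<in>vector_fields C. g (vscale f X) Y = f * g X Y) \<and>
     (\<forall>X Y. real_field C X \<longrightarrow> real_field C Y \<longrightarrow> range (g X Y) \<subseteq> \<real>) \<and>
     (\<forall>X p. real_field C X \<longrightarrow> (\<exists>f\<in>C. X f p \<noteq> 0) \<longrightarrow> (\<exists>r>0. g X X p = of_real r))"

text \<open>
  The metric on 1-forms induced by \<open>g\<close>: \<open>(\<omega>, \<eta>) = \<eta>(X)\<close>, where \<open>X\<close> is the vector field with
  \<open>g(X, -) = \<omega>\<close>.
\<close>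

definition inverse_metric ::
  "('m \<Rightarrow> 'k::real_normed_field) set \<Rightarrow> (('m, 'k) vfield \<Rightarrow> ('m, 'k) vfield \<Rightarrow> ('m \<Rightarrow> 'k))
    \<Rightarrow> (('m, 'k) form \<Rightarrow> ('m, 'k) form \<Rightarrow> ('m \<Rightarrow> 'k)) \<Rightarrow> bool" where
  "inverse_metric C g ip \<longleftrightarrow>
     (\<forall>\<omega>\<in>one_forms C. \<exists>X\<in>vector_fields C.
        (\<forall>Y\<in>vector_fields C. g X Y = \<omega> Y) \<and> (\<forall>\<eta>\<in>one_forms C. ip \<omega> \<eta> = \<eta> X))"

text \<open>The vector field \<open>\<omega>\<^sup>* = (\<omega>, -)\<close> dual to \<open>\<omega>\<close>.\<close>

definition dual_field ::
  "('m \<Rightarrow> 'k::real_normed_field) set \<Rightarrow> (('m, 'k) form \<Rightarrow> ('m, 'k) form \<Rightarrow> ('m \<Rightarrow> 'k))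
    \<Rightarrow> ('m, 'k) form \<Rightarrow> ('m, 'k) vfield" where
  "dual_field C ip \<omega> = (\<lambda>f. if f \<in> C then ip \<omega> (ext_d C f) else 0)"


section \<open>Bimodules and tensor squares\<close>

record ('a, 'x) bimod =
  scalars :: "'a set"
  carr :: "'x set"
  lact :: "'a \<Rightarrow> 'x \<Rightarrow> 'x"
  ract :: "'x \<Rightarrow> 'a \<Rightarrow> 'x"

text \<open>
  The tensor product of a bimodule with itself over its scalars, as the free abelian group on
  pairs modulo the subgroup \<open>tensor_null\<close> generated by the usual relators.  Its elements are
  cosets, and \<open>+\<close> on them is the elementwise sum of sets.  There is no subtraction here:
  a minus on sets is the set difference, hence negative terms are written with the
  left action of a negative constant.
\<close>

type_synonym 'x tens = "(('x \<times> 'x) \<Rightarrow>\<^sub>0 int) set"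

definition tensor_relators ::
  "('a, 'x::ab_group_add, 'z) bimod_scheme \<Rightarrow> (('x \<times> 'x) \<Rightarrow>\<^sub>0 int) set" where
  "tensor_relators N =
     {frag_of (x + x', y) - frag_of (x, y) - frag_of (x', y) | x x' y.
        x \<in> carr N \<and> x' \<in> carr N \<and> y \<in> carr N} \<union>
     {frag_of (x, y + y') - frag_of (x, y) - frag_of (x, y') | x y y'.
        x \<in> carr N \<and> y \<in> carr N \<and> y' \<in> carr N} \<union>
     {frag_of (ract N x a, y) - frag_of (x, lact N a y) | x a y.
        x \<in> carr N \<and> a \<in> scalars N \<and> y \<in> carr N}"

definition tensor_null ::
  "('a, 'x::ab_group_add, 'z) bimod_scheme \<Rightarrow> (('x \<times> 'x) \<Rightarrow>\<^sub>0 int) set" where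
  "tensor_null N = (\<lambda>H. 0 \<in> H \<and> (\<forall>u\<in>H. \<forall>v\<in>H. u - v \<in> H)) hull tensor_relators N"

definition tensor_space :: "('a, 'x::ab_group_add, 'z) bimod_scheme \<Rightarrow> 'x tens set" where
  "tensor_space N = {c +o tensor_null N | c. Poly_Mapping.keys c \<subseteq> carr N \<times> carr N}"

definition elem_tensor ::
  "'x::ab_group_add \<Rightarrow> ('a, 'x, 'z) bimod_scheme \<Rightarrow> 'x \<Rightarrow> 'x tens"
  ("(_ \<otimes>\<^bsub>_\<^esub> _)" [76, 0, 76] 75) where
  "x \<otimes>\<^bsub>N\<^esub> y = frag_of (x, y) +o tensor_null N"

text \<open>
  The additive map on the tensor square with value \<open>s x y\<close> on \<open>x \<otimes> y\<close>, for a balanced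
  biadditive map \<open>s\<close>.
\<close>

definition tensor_lift ::
  "('a, 'x::ab_group_add, 'z) bimod_scheme \<Rightarrow> ('x \<Rightarrow> 'x \<Rightarrow> 'w::plus) \<Rightarrow> 'x tens \<Rightarrow> 'w" where
  "tensor_lift N s = (THE h. h \<in> extensional (tensor_space N) \<and>
     (\<forall>u\<in>tensor_space N. \<forall>v\<in>tensor_space N. h (u + v) = h u + h v) \<and>
     (\<forall>x\<in>carr N. \<forall>y\<in>carr N. h (x \<otimes>\<^bsub>N\<^esub> y) = s x y))"

definition tensor_lact ::
  "'a \<Rightarrow> ('a, 'x::ab_group_add, 'z) bimod_scheme \<Rightarrow> 'x tens \<Rightarrow> 'x tens"
  ("(_ \<cdot>\<^bsub>_\<^esub> _)" [74, 0, 73] 73) where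
  "a \<cdot>\<^bsub>N\<^esub> t = tensor_lift N (\<lambda>x y. lact N a x \<otimes>\<^bsub>N\<^esub> y) t"

definition tensor_ract ::
  "'x tens \<Rightarrow> ('a, 'x::ab_group_add, 'z) bimod_scheme \<Rightarrow> 'a \<Rightarrow> 'x tens"
  ("(_ \<bullet>\<^bsub>_\<^esub> _)" [73, 0, 74] 73) where
  "t \<bullet>\<^bsub>N\<^esub> a = tensor_lift N (\<lambda>x y. x \<otimes>\<^bsub>N\<^esub> ract N y a) t"

text \<open>
  Homogeneity with respect to constants is contained in the Leibniz rule, because \<open>d\<close>
  vanishes on constants in the calculi considered here.
\<close>

definition left_connection ::
  "('a, 'x::ab_group_add, 'z) bimod_scheme \<Rightarrow> ('a \<Rightarrow> 'x) \<Rightarrow> ('x \<Rightarrow> 'x tens) \<Rightarrow> bool" where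
  "left_connection N d nab \<longleftrightarrow>
     (\<forall>x\<in>carr N. nab x \<in> tensor_space N) \<and>
     (\<forall>x\<in>carr N. \<forall>y\<in>carr N. nab (x + y) = nab x + nab y) \<and>
     (\<forall>a\<in>scalars N. \<forall>x\<in>carr N. nab (lact N a x) = d a \<otimes>\<^bsub>N\<^esub> x + a \<cdot>\<^bsub>N\<^esub> nab x)"

definition tensor_bimodule_map ::
  "('a, 'x::ab_group_add, 'z) bimod_scheme \<Rightarrow> ('x tens \<Rightarrow> 'x tens) \<Rightarrow> bool" where
  "tensor_bimodule_map N \<sigma> \<longleftrightarrow>
     (\<forall>t\<in>tensor_space N. \<sigma> t \<in> tensor_space N) \<and>
     (\<forall>t\<in>tensor_space N. \<forall>u\<in>tensor_space N. \<sigma> (t + u) = \<sigma> t + \<sigma> u) \<and>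
     (\<forall>a\<in>scalars N. \<forall>t\<in>tensor_space N.
        \<sigma> (a \<cdot>\<^bsub>N\<^esub> t) = a \<cdot>\<^bsub>N\<^esub> \<sigma> t \<and> \<sigma> (t \<bullet>\<^bsub>N\<^esub> a) = \<sigma> t \<bullet>\<^bsub>N\<^esub> a)"

definition bimodule_connection ::
  "('a, 'x::ab_group_add, 'z) bimod_scheme \<Rightarrow> ('a \<Rightarrow> 'x) \<Rightarrow> ('x \<Rightarrow> 'x tens)
    \<Rightarrow> ('x tens \<Rightarrow> 'x tens) \<Rightarrow> bool" where
  "bimodule_connection N d nab \<sigma> \<longleftrightarrow>
     left_connection N d nab \<and> tensor_bimodule_map N \<sigma> \<and>
     (\<forall>x\<in>carr N. \<forall>a\<in>scalars N. nab (ract N x a) = nab x \<bullet>\<^bsub>N\<^esub> a + \<sigma> (x \<otimes>\<^bsub>N\<^esub> d a))"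


section \<open>The classical bimodule of 1-forms and its Levi-Civita connection\<close>

definition classical_forms ::
  "('m \<Rightarrow> 'k::real_normed_field) set \<Rightarrow> ('m \<Rightarrow> 'k, ('m, 'k) form) bimod" where
  "classical_forms C =
     \<lparr>scalars = C, carr = one_forms C, lact = fscale, ract = (\<lambda>\<omega> f. fscale f \<omega>)\<rparr>"

text \<open>\<open>\<nabla>\<^sub>X\<omega>\<close>, evaluating the first tensor factor of \<open>\<nabla>\<omega>\<close> at \<open>X\<close>.\<close>

definition cov_deriv ::
  "('m \<Rightarrow> 'k::real_normed_field) set \<Rightarrow> (('m, 'k) form \<Rightarrow> ('m, 'k) form tens)
    \<Rightarrow> ('m, 'k) vfield \<Rightarrow> ('m, 'k) form \<Rightarrow> ('m, 'k) form" where
  "cov_deriv C nb X \<omega> = tensor_lift (classical_forms C) (\<lambda>\<alpha> \<beta>. fscale (\<alpha> X) \<beta>) (nb \<omega>)"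

text \<open>
  The torsion condition equates the antisymmetrisation
  of \<open>\<nabla>\<omega>\<close> with the exterior derivative of \<open>\<omega>\<close>.
\<close>

definition levi_civita ::
  "('m \<Rightarrow> 'k::real_normed_field) set \<Rightarrow> (('m, 'k) form \<Rightarrow> ('m, 'k) form \<Rightarrow> ('m \<Rightarrow> 'k))
    \<Rightarrow> (('m, 'k) form \<Rightarrow> ('m, 'k) form tens) \<Rightarrow> bool" where
  "levi_civita C ip nb \<longleftrightarrow>
     left_connection (classical_forms C) (ext_d C) nb \<and>
     (\<forall>\<omega>\<in>one_forms C. \<forall>X\<in>vector_fields C. \<forall>Y\<in>vector_fields C.
        cov_deriv C nb X \<omega> Y - cov_deriv C nb Y \<omega> X
          = X (\<omega> Y) - Y (\<omega> X) - \<omega> (lie_bracket X Y)) \<and>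
     (\<forall>\<omega>\<in>one_forms C. \<forall>\<eta>\<in>one_forms C. \<forall>X\<in>vector_fields C.
        X (ip \<omega> \<eta>) = ip (cov_deriv C nb X \<omega>) \<eta> + ip \<omega> (cov_deriv C nb X \<eta>))"

definition cov_deriv_form ::
  "('m \<Rightarrow> 'k::real_normed_field) set \<Rightarrow> (('m, 'k) form \<Rightarrow> ('m, 'k) form \<Rightarrow> ('m \<Rightarrow> 'k))
    \<Rightarrow> (('m, 'k) form \<Rightarrow> ('m, 'k) form tens) \<Rightarrow> ('m, 'k) form \<Rightarrow> ('m, 'k) form
    \<Rightarrow> ('m, 'k) form" where
  "cov_deriv_form C ip nb \<omega> \<eta> = cov_deriv C nb (dual_field C ip \<omega>) \<eta>"

text \<open>\<open>(\<alpha> \<otimes> \<beta>, \<gamma> \<otimes> \<delta>) = (\<alpha>, \<gamma>)(\<beta>, \<delta>)\<close>\<close>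

definition tensor_metric ::
  "('m \<Rightarrow> 'k::real_normed_field) set \<Rightarrow> (('m, 'k) form \<Rightarrow> ('m, 'k) form \<Rightarrow> ('m \<Rightarrow> 'k))
    \<Rightarrow> ('m, 'k) form tens \<Rightarrow> ('m, 'k) form tens \<Rightarrow> ('m \<Rightarrow> 'k)" where
  "tensor_metric C ip u v =
     tensor_lift (classical_forms C)
       (\<lambda>\<alpha> \<beta>. tensor_lift (classical_forms C) (\<lambda>\<gamma> \<delta>. ip \<alpha> \<gamma> * ip \<beta> \<delta>) v) u"

definition tensorial ::
  "('m \<Rightarrow> 'k::real_normed_field) set \<Rightarrow> (('m, 'k) form \<Rightarrow> ('m, 'k) form) \<Rightarrow> bool" where
  "tensorial C K \<longleftrightarrow>
     (\<forall>\<omega>\<in>one_forms C. K \<omega> \<in> one_forms C) \<and>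
     (\<forall>\<omega>\<in>one_forms C. \<forall>\<eta>\<in>one_forms C. K (\<omega> + \<eta>) = K \<omega> + K \<eta>) \<and>
     (\<forall>f\<in>C. \<forall>\<omega>\<in>one_forms C. K (fscale f \<omega>) = fscale f (K \<omega>))"

text \<open>
  \<open>D0\<close> and \<open>D1\<close> are the operator on functions and on 1-forms, \<open>Ric\<close> the associated tensor.
\<close>

definition laplacian ::
  "('m \<Rightarrow> 'k::real_normed_field) set \<Rightarrow> (('m, 'k) form \<Rightarrow> ('m, 'k) form \<Rightarrow> ('m \<Rightarrow> 'k))
    \<Rightarrow> (('m, 'k) form \<Rightarrow> ('m, 'k) form tens)
    \<Rightarrow> (('m \<Rightarrow> 'k) \<Rightarrow> ('m \<Rightarrow> 'k)) \<Rightarrow> (('m, 'k) form \<Rightarrow> ('m, 'k) form)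
    \<Rightarrow> (('m, 'k) form \<Rightarrow> ('m, 'k) form) \<Rightarrow> bool" where
  "laplacian C ip nb D0 D1 Ric \<longleftrightarrow>
     (\<forall>f\<in>C. D0 f \<in> C) \<and>
     (\<forall>f\<in>C. \<forall>h\<in>C. D0 (f + h) = D0 f + D0 h) \<and>
     (\<forall>c. \<forall>f\<in>C. D0 ((\<lambda>_. c) * f) = (\<lambda>_. c) * D0 f) \<and>
     (\<forall>\<omega>\<in>one_forms C. D1 \<omega> \<in> one_forms C) \<and>
     (\<forall>\<omega>\<in>one_forms C. \<forall>\<eta>\<in>one_forms C. D1 (\<omega> + \<eta>) = D1 \<omega> + D1 \<eta>) \<and>
     (\<forall>c. \<forall>\<omega>\<in>one_forms C. D1 (fscale (\<lambda>_. c) \<omega>) = fscale (\<lambda>_. c) (D1 \<omega>)) \<and>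
     (\<forall>f\<in>C. \<forall>h\<in>C. D0 (f * h) = D0 f * h + f * D0 h + 2 * ip (ext_d C f) (ext_d C h)) \<and>
     (\<forall>f\<in>C. \<forall>\<omega>\<in>one_forms C.
        D1 (fscale f \<omega>) = fscale (D0 f) \<omega> + fscale f (D1 \<omega>)
          + 2 * cov_deriv_form C ip nb (ext_d C f) \<omega>) \<and>
     (\<forall>\<omega>\<in>one_forms C. \<forall>\<eta>\<in>one_forms C.
        D0 (ip \<omega> \<eta>) = ip (D1 \<omega>) \<eta> + ip \<omega> (D1 \<eta>) + 2 * tensor_metric C ip (nb \<omega>) (nb \<eta>)) \<and>
     tensorial C Ric \<and>
     (\<forall>f\<in>C. D1 (ext_d C f) - ext_d C (D0 f) = Ric (ext_d C f))"


section \<open>The noncommutative calculus\<close>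

text \<open>The pair \<open>(\<omega>, h)\<close> stands for \<open>\<omega> + h\<theta>'\<close>.\<close>

type_synonym ('m, 'k) ncform = "('m, 'k) form \<times> ('m \<Rightarrow> 'k)"

definition nc_forms ::
  "('m \<Rightarrow> 'k::real_normed_field) set \<Rightarrow> (('m, 'k) form \<Rightarrow> ('m, 'k) form \<Rightarrow> ('m \<Rightarrow> 'k))
    \<Rightarrow> 'k \<Rightarrow> ('m \<Rightarrow> 'k, ('m, 'k) ncform) bimod" where
  "nc_forms C ip lam =
     \<lparr>scalars = C, carr = one_forms C \<times> C,
      lact = (\<lambda>f (\<omega>, h). (fscale f \<omega>, f * h)),
      ract = (\<lambda>(\<omega>, h) f. (fscale f \<omega>, h * f + (\<lambda>_. lam) * ip \<omega> (ext_d C f)))\<rparr>"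

definition nc_d ::
  "('m \<Rightarrow> 'k::real_normed_field) set \<Rightarrow> (('m \<Rightarrow> 'k) \<Rightarrow> ('m \<Rightarrow> 'k)) \<Rightarrow> 'k
    \<Rightarrow> ('m \<Rightarrow> 'k) \<Rightarrow> ('m, 'k) ncform" where
  "nc_d C D0 lam f = (ext_d C f, (\<lambda>_. lam / 2) * D0 f)"

definition emb :: "('m, 'k::real_normed_field) form \<Rightarrow> ('m, 'k) ncform" where
  "emb \<omega> = (\<omega>, 0)"

definition theta :: "('m, 'k::real_normed_field) ncform" where
  "theta = (0, 1)"

definition phi ::
  "('m \<Rightarrow> 'k::real_normed_field) set \<Rightarrow> (('m, 'k) form \<Rightarrow> ('m, 'k) form \<Rightarrow> ('m \<Rightarrow> 'k))
    \<Rightarrow> (('m, 'k) form \<Rightarrow> ('m, 'k) form tens) \<Rightarrow> 'k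
    \<Rightarrow> ('m, 'k) form tens \<Rightarrow> ('m, 'k) ncform tens" where
  "phi C ip nb lam = tensor_lift (classical_forms C)
     (\<lambda>\<omega> \<eta>. emb \<omega> \<otimes>\<^bsub>nc_forms C ip lam\<^esub> emb \<eta>
        + (\<lambda>_. - lam) \<cdot>\<^bsub>nc_forms C ip lam\<^esub>
            (theta \<otimes>\<^bsub>nc_forms C ip lam\<^esub> emb (cov_deriv_form C ip nb \<omega> \<eta>)))"

end

theory Submission
  imports Defs
begin

text \<open>
  For \<open>x = \<omega> + h\<theta>'\<close> and \<open>y = \<eta> + k\<theta>'\<close> put
  \<open>\<sigma>(x \<otimes> y) = y \<otimes> x + \<lambda> \<nabla>\<^sub>\<omega>\<eta> \<otimes> \<theta>' - \<lambda> \<theta>' \<otimes> \<nabla>\<^sub>\<eta>\<omega> + \<lambda>(\<omega>,\<eta>) \<nabla>\<theta>' + c \<theta>' \<otimes> \<theta>'\<close> with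
  \<open>c = \<lambda>(\<omega>,dk) - \<lambda>(\<eta>,dh) + \<lambda>\<^sup>2/2 ((\<omega>, Ric \<eta>) + (\<eta>, K\<omega>))\<close>.  On 1-forms and \<open>\<theta>'\<close> these are the four
  prescribed values.  That \<open>\<sigma>\<close> is a bimodule map and that the connection law holds is then a
  computation with the one commutation rule
  \<open>x \<otimes> f y = f (x \<otimes> y) + \<lambda>(\<omega>,df) \<theta>' \<otimes> y\<close> (lemma \<open>elem_lact\<close>), whose correction terms are absorbed
  as follows.

  \<^item> The formula is balanced and left linear because the derivative term
    \<open>\<nabla>\<^sub>\<omega>(f\<eta>) = f \<nabla>\<^sub>\<omega>\<eta> + (\<omega>,df) \<eta>\<close> produces the same corrections as the commutation rule
    (\<open>braid_lact_left\<close>, \<open>braid_balanced\<close>).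

  \<^item> Right linearity leaves a term of second order in \<open>\<lambda>\<close>.  It vanishes because
    \<open>(\<omega>, d(\<eta>,df)) - (\<eta>, d(\<omega>,df)) = (\<nabla>\<^sub>\<omega>\<eta>, df) - (\<nabla>\<^sub>\<eta>\<omega>, df)\<close> for a metric connection
    without torsion; here \<open>(\<omega>, d(\<eta>,df))\<close> is \<open>\<omega>\<^sup>*(\<eta>\<^sup>*(f))\<close>, so this is the formula
    \<open>[X,Y] = \<nabla>\<^sub>XY - \<nabla>\<^sub>YX\<close> (\<open>ip_d_ip_commutator\<close>, \<open>braid_ract_right\<close>).

  \<^item> The connection law is compatible with sums and left multiples, hence has to be checked
    on \<open>\<theta>'\<close>, where it is the assumption that \<open>\<nabla>\<theta>'\<close> commutes with functions, and on a 1-form \<open>\<omega>\<close>.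
    The commutator of \<open>\<phi>(\<nabla>\<omega>)\<close> with \<open>f\<close> consists of three contractions of \<open>\<nabla>\<omega>\<close>, namely
    \<open>\<nabla>\<^bsub>df\<^esub>\<omega>\<close>, \<open>d(\<omega>,df) - \<nabla>\<^sub>\<omega>df\<close> and \<open>(\<nabla>\<omega>,\<nabla>df)\<close> (\<open>phi_map_ract\<close>, \<open>d_ip\<close>, \<open>tensor_metric_hessian\<close>).
    All coefficients then agree at once except that of \<open>\<theta>' \<otimes> \<theta>'\<close>, where equality is the product
    rule \<open>\<Delta>(\<omega>,df) = (\<Delta>\<omega>,df) + (\<omega>,\<Delta>df) + 2(\<nabla>\<omega>,\<nabla>df)\<close> with \<open>\<Delta>df = d\<Delta>f + Ric(df)\<close>
    (\<open>nab_ract_emb\<close>).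

  The argument is algebraic over the ring of smooth functions: the manifold supplies a ring of
  functions that contains the constants.  The remaining work is to make the tensor square
  usable, that is, to produce additive maps out of it from balanced ones and to collect
  coefficients in it.
\<close>

section \<open>The algebra of smooth functions\<close>

lemma frechet_derivative_eq_on_open:
  assumes "open S" "x \<in> S" "\<forall>y\<in>S. f y = g y"
  shows "f differentiable (at x) \<longleftrightarrow> g differentiable (at x)"
    and "frechet_derivative f (at x) = frechet_derivative g (at x)"
proof -
  have eq: "(f has_derivative D) (at x) \<longleftrightarrow> (g has_derivative D) (at x)" for D
    using assms has_derivative_transform_within_open[of f D x UNIV S g]
      has_derivative_transform_within_open[of g D x UNIV S f] by auto
  show "f differentiable (at x) \<longleftrightarrow> g differentiable (at x)"
    by (simp add: differentiable_def eq)
  show "frechet_derivative f (at x) = frechet_derivative g (at x)"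
    by (simp add: frechet_derivative_def eq)
qed

text \<open>
  Openness of the domain lets the derivatives, taken in the whole space, depend only on the
  values on the domain.
\<close>

lemma Ck_on_cong:
  assumes "open S" "\<forall>x\<in>S. f x = g x"
  shows "Ck_on n S f \<longleftrightarrow> Ck_on n S g"
  using assms(2)
proof (induction n arbitrary: f g)
  case 0
  then show ?case by (simp cong: continuous_on_cong)
next
  case (Suc n)
  have "Ck_on n S (\<lambda>x. frechet_derivative f (at x) v) \<longleftrightarrow>
      Ck_on n S (\<lambda>x. frechet_derivative g (at x) v)" for v
    using frechet_derivative_eq_on_open(2)[OF assms(1) _ Suc.prems] by (intro Suc.IH) simp
  then show ?case
    using frechet_derivative_eq_on_open(1)[OF assms(1) _ Suc.prems] by simp
qed

lemma Ck_on_SucD: "Ck_on (Suc n) S f \<Longrightarrow> Ck_on n S f"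
proof (induction n arbitrary: f)
  case 0
  then show ?case
    by (auto intro!: continuous_at_imp_continuous_on differentiable_imp_continuous_within)
next
  case (Suc n)
  then show ?case by (metis Ck_on.simps(2))
qed

lemma Ck_on_const: "Ck_on n S (\<lambda>x. c)"
  by (induction n arbitrary: c) (simp_all add: frechet_derivative_const)

lemma Ck_on_add:
  assumes "open S"
  shows "Ck_on n S f \<Longrightarrow> Ck_on n S g \<Longrightarrow> Ck_on n S (\<lambda>x. f x + g x)"
proof (induction n arbitrary: f g)
  case 0
  then show ?case by (simp add: continuous_on_add)
next
  case (Suc n)
  have deriv: "frechet_derivative (\<lambda>x. f x + g x) (at x) v =
      frechet_derivative f (at x) v + frechet_derivative g (at x) v" if "x \<in> S" for x v
  proof -
    have "(f has_derivative frechet_derivative f (at x)) (at x)"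
      "(g has_derivative frechet_derivative g (at x)) (at x)"
      using Suc.prems that by (auto simp: frechet_derivative_works)
    from frechet_derivative_at[OF has_derivative_add[OF this]] show ?thesis
      by (simp add: fun_eq_iff)
  qed
  have "Ck_on n S (\<lambda>x. frechet_derivative (\<lambda>x. f x + g x) (at x) v) \<longleftrightarrow>
      Ck_on n S (\<lambda>x. frechet_derivative f (at x) v + frechet_derivative g (at x) v)" for v
    using deriv by (intro Ck_on_cong[OF assms]) auto
  then show ?case
    using Suc by (auto intro: differentiable_add)
qed

lemma Ck_on_mult:
  fixes f g :: "'a::real_normed_vector \<Rightarrow> 'b::real_normed_algebra"
  assumes "open S"
  shows "Ck_on n S f \<Longrightarrow> Ck_on n S g \<Longrightarrow> Ck_on n S (\<lambda>x. f x * g x)"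
proof (induction n arbitrary: f g)
  case 0
  then show ?case by (simp add: continuous_on_mult)
next
  case (Suc n)
  have deriv: "frechet_derivative (\<lambda>x. f x * g x) (at x) v =
      f x * frechet_derivative g (at x) v + frechet_derivative f (at x) v * g x"
    if "x \<in> S" for x v
  proof -
    have "(f has_derivative frechet_derivative f (at x)) (at x)"
      "(g has_derivative frechet_derivative g (at x)) (at x)"
      using Suc.prems that by (auto simp: frechet_derivative_works)
    from frechet_derivative_at[OF has_derivative_mult[OF this]] show ?thesis
      by (simp add: fun_eq_iff)
  qed
  have "Ck_on n S (\<lambda>x. frechet_derivative (\<lambda>x. f x * g x) (at x) v) \<longleftrightarrow>
      Ck_on n S (\<lambda>x. f x * frechet_derivative g (at x) v + frechet_derivative f (at x) v * g x)" for v
    using deriv by (intro Ck_on_cong[OF assms]) auto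
  moreover have "Ck_on n S (\<lambda>x. f x * frechet_derivative g (at x) v + frechet_derivative f (at x) v * g x)" for v
    using Suc.prems Suc.IH Ck_on_SucD[OF Suc.prems(1)] Ck_on_SucD[OF Suc.prems(2)]
    by (intro Ck_on_add[OF assms]) auto
  ultimately show ?case
    using Suc.prems by (auto intro: differentiable_mult)
qed

lemma smooth_functions_closed:
  assumes "smooth_atlas \<A>"
  shows smooth_functions_const: "(\<lambda>_. c) \<in> smooth_functions \<A>"
    and smooth_functions_add:
      "f \<in> smooth_functions \<A> \<Longrightarrow> h \<in> smooth_functions \<A> \<Longrightarrow> f + h \<in> smooth_functions \<A>"
    and smooth_functions_mult:
      "f \<in> smooth_functions \<A> \<Longrightarrow> h \<in> smooth_functions \<A> \<Longrightarrow> f * h \<in> smooth_functions \<A>"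
proof -
  have op: "open (\<phi> ` U)" if "(U, \<phi>) \<in> \<A>" for U \<phi>
    using assms that by (force simp: smooth_atlas_def is_chart_def)
  show "(\<lambda>_. c) \<in> smooth_functions \<A>"
    by (auto simp: smooth_functions_def smooth_on_def o_def Ck_on_const)
  show "f \<in> smooth_functions \<A> \<Longrightarrow> h \<in> smooth_functions \<A> \<Longrightarrow> f + h \<in> smooth_functions \<A>"
    using Ck_on_add[OF op] by (fastforce simp: smooth_functions_def smooth_on_def o_def)
  show "f \<in> smooth_functions \<A> \<Longrightarrow> h \<in> smooth_functions \<A> \<Longrightarrow> f * h \<in> smooth_functions \<A>"
    using Ck_on_mult[OF op] by (fastforce simp: smooth_functions_def smooth_on_def o_def)
qed

section \<open>Tensor squares of bimodules\<close>

definition biadditive_balanced ::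
  "('a, 'x::ab_group_add, 'z) bimod_scheme \<Rightarrow> ('x \<Rightarrow> 'x \<Rightarrow> 'w::plus) \<Rightarrow> bool" where
  "biadditive_balanced N s \<longleftrightarrow>
     (\<forall>x\<in>carr N. \<forall>x'\<in>carr N. \<forall>y\<in>carr N. s (x + x') y = s x y + s x' y) \<and>
     (\<forall>x\<in>carr N. \<forall>y\<in>carr N. \<forall>y'\<in>carr N. s x (y + y') = s x y + s x y') \<and>
     (\<forall>x\<in>carr N. \<forall>a\<in>scalars N. \<forall>y\<in>carr N. s (ract N x a) y = s x (lact N a y))"

lemma tensor_null_subgroup:
  shows tensor_null_zero: "0 \<in> tensor_null N"
    and tensor_null_diff: "u \<in> tensor_null N \<Longrightarrow> v \<in> tensor_null N \<Longrightarrow> u - v \<in> tensor_null N"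
proof -
  have "(\<lambda>H. 0 \<in> H \<and> (\<forall>u\<in>H. \<forall>v\<in>H. u - v \<in> H)) (tensor_null N)"
    unfolding tensor_null_def by (rule hull_in) auto
  then show "0 \<in> tensor_null N" "u \<in> tensor_null N \<Longrightarrow> v \<in> tensor_null N \<Longrightarrow> u - v \<in> tensor_null N"
    by auto
qed

lemma tensor_null_uminus: "u \<in> tensor_null N \<Longrightarrow> - u \<in> tensor_null N"
  using tensor_null_diff[OF tensor_null_zero] by fastforce

lemma tensor_null_add: "u \<in> tensor_null N \<Longrightarrow> v \<in> tensor_null N \<Longrightarrow> u + v \<in> tensor_null N"
  using tensor_null_diff[OF _ tensor_null_uminus] by fastforce

text \<open>
  A homomorphism on the free abelian group that kills the relators kills \<open>tensor_null N\<close>: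
  take its kernel for \<open>H\<close>.
\<close>

lemma tensor_null_least:
  assumes "\<And>u. u \<in> tensor_relators N \<Longrightarrow> u \<in> H"
    and "0 \<in> H" "\<And>u v. u \<in> H \<Longrightarrow> v \<in> H \<Longrightarrow> u - v \<in> H"
  shows "u \<in> tensor_null N \<Longrightarrow> u \<in> H"
  using hull_minimal[of "tensor_relators N" H "\<lambda>H. 0 \<in> H \<and> (\<forall>u\<in>H. \<forall>v\<in>H. u - v \<in> H)"] assms
  unfolding tensor_null_def by blast

lemma tensor_null_plus_self: "tensor_null N + tensor_null N = tensor_null N"
  using tensor_null_add tensor_null_zero[of N]
  by (auto simp: set_plus_def) (metis add_0)

lemma tensor_coset_eq_iff:
  "c +o tensor_null N = d +o tensor_null N \<longleftrightarrow> c - d \<in> tensor_null N"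
proof
  assume "c +o tensor_null N = d +o tensor_null N"
  moreover have "c \<in> c +o tensor_null N"
    using tensor_null_zero[of N] by (force simp: elt_set_plus_def)
  ultimately show "c - d \<in> tensor_null N"
    using set_plus_imp_minus by blast
next
  assume cd: "c - d \<in> tensor_null N"
  have "d - c \<in> tensor_null N"
    using tensor_null_uminus[OF cd] by simp
  then have "u \<in> c +o tensor_null N \<longleftrightarrow> u \<in> d +o tensor_null N" for u
    using cd tensor_null_add[of "u - c" N "c - d"] tensor_null_add[of "u - d" N "d - c"]
    by (auto simp flip: set_minus_plus)
  then show "c +o tensor_null N = d +o tensor_null N"
    by blast
qed

lemma tensor_coset_add:
  "(c +o tensor_null N) + (d +o tensor_null N) = (c + d) +o tensor_null N"
  by (simp add: set_plus_rearrange tensor_null_plus_self)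

lemma tensor_space_add: "t \<in> tensor_space N \<Longrightarrow> u \<in> tensor_space N \<Longrightarrow> t + u \<in> tensor_space N"
  unfolding tensor_space_def
  using Poly_Mapping.keys_add by (force simp: tensor_coset_add)

lemma elem_tensor_in_space [simp]: "x \<in> carr N \<Longrightarrow> y \<in> carr N \<Longrightarrow> (x \<otimes>\<^bsub>N\<^esub> y) \<in> tensor_space N"
  by (force simp: tensor_space_def elem_tensor_def)

lemma tensor_null_in_space [simp]: "tensor_null N \<in> tensor_space N"
  unfolding tensor_space_def by (force intro: exI[of _ 0])

lemma tensor_null_add_left: "t \<in> tensor_space N \<Longrightarrow> tensor_null N + t = t"
  using tensor_coset_add[of 0 N] by (force simp: tensor_space_def)

lemma tensor_null_add_right: "t \<in> tensor_space N \<Longrightarrow> t + tensor_null N = t"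
  by (simp add: add.commute[of t] tensor_null_add_left)

lemma elem_tensor_biadditive_balanced: "biadditive_balanced N (\<lambda>x y. x \<otimes>\<^bsub>N\<^esub> y)"
proof -
  have rel: "u \<in> tensor_relators N \<Longrightarrow> u \<in> tensor_null N" for u
    unfolding tensor_null_def by (rule hull_inc)
  show ?thesis
    unfolding biadditive_balanced_def elem_tensor_def tensor_coset_add tensor_coset_eq_iff
      diff_diff_eq[symmetric]
    by (intro conjI ballI rel) (unfold tensor_relators_def, blast+)
qed

lemma elem_tensor_add_left:
  "x \<in> carr N \<Longrightarrow> x' \<in> carr N \<Longrightarrow> y \<in> carr N \<Longrightarrow> (x + x') \<otimes>\<^bsub>N\<^esub> y = x \<otimes>\<^bsub>N\<^esub> y + x' \<otimes>\<^bsub>N\<^esub> y"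
  and elem_tensor_add_right:
  "x \<in> carr N \<Longrightarrow> y \<in> carr N \<Longrightarrow> y' \<in> carr N \<Longrightarrow> x \<otimes>\<^bsub>N\<^esub> (y + y') = x \<otimes>\<^bsub>N\<^esub> y + x \<otimes>\<^bsub>N\<^esub> y'"
  and elem_tensor_balanced:
  "x \<in> carr N \<Longrightarrow> a \<in> scalars N \<Longrightarrow> y \<in> carr N \<Longrightarrow> ract N x a \<otimes>\<^bsub>N\<^esub> y = x \<otimes>\<^bsub>N\<^esub> lact N a y"
  using elem_tensor_biadditive_balanced[of N] by (auto simp: biadditive_balanced_def)

text \<open>
  A coset determines its representatives only up to the relators, so a lift is built on the free
  abelian group and descends as soon as it does not see \<open>tensor_null\<close>.
\<close>

lemma lift_descends:
  fixes H :: "('x::ab_group_add \<times> 'x \<Rightarrow>\<^sub>0 int) \<Rightarrow> 'w::plus"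
  assumes add: "\<And>c d. H (c + d) = H c + H d"
    and null: "\<And>c u. u \<in> tensor_null N \<Longrightarrow> H (c + u) = H c"
    and gen: "\<And>x y. x \<in> carr N \<Longrightarrow> y \<in> carr N \<Longrightarrow> H (frag_of (x, y)) = s x y"
  obtains h where "\<forall>t\<in>tensor_space N. \<forall>u\<in>tensor_space N. h (t + u) = h t + h u"
    and "\<forall>x\<in>carr N. \<forall>y\<in>carr N. h (x \<otimes>\<^bsub>N\<^esub> y) = s x y"
proof -
  define h where "h t = H (SOME c. t = c +o tensor_null N)" for t
  have h: "h (c +o tensor_null N) = H c" for c
  proof -
    have "c +o tensor_null N = (SOME d. c +o tensor_null N = d +o tensor_null N) +o tensor_null N"
      by (rule someI) simp
    then have "(SOME d. c +o tensor_null N = d +o tensor_null N) - c \<in> tensor_null N"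
      using tensor_coset_eq_iff by metis
    from null[OF this, of c] show ?thesis
      by (simp add: h_def)
  qed
  show thesis
  proof
    show "\<forall>t\<in>tensor_space N. \<forall>u\<in>tensor_space N. h (t + u) = h t + h u"
      by (auto simp: tensor_space_def tensor_coset_add h add)
    show "\<forall>x\<in>carr N. \<forall>y\<in>carr N. h (x \<otimes>\<^bsub>N\<^esub> y) = s x y"
      by (simp add: elem_tensor_def h gen)
  qed
qed

locale bimodule =
  fixes N :: "('a::comm_ring_1, 'x::ab_group_add) bimod"
  assumes scalar_one [simp]: "1 \<in> scalars N"
    and scalar_add [simp]: "a \<in> scalars N \<Longrightarrow> b \<in> scalars N \<Longrightarrow> a + b \<in> scalars N"
    and scalar_uminus [simp]: "a \<in> scalars N \<Longrightarrow> - a \<in> scalars N"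
    and scalar_mult [simp]: "a \<in> scalars N \<Longrightarrow> b \<in> scalars N \<Longrightarrow> a * b \<in> scalars N"
    and zero_closed [simp]: "0 \<in> carr N"
    and add_closed [simp]: "x \<in> carr N \<Longrightarrow> y \<in> carr N \<Longrightarrow> x + y \<in> carr N"
    and lact_closed [simp]: "a \<in> scalars N \<Longrightarrow> x \<in> carr N \<Longrightarrow> lact N a x \<in> carr N"
    and ract_closed [simp]: "a \<in> scalars N \<Longrightarrow> x \<in> carr N \<Longrightarrow> ract N x a \<in> carr N"
    and lact_add: "a \<in> scalars N \<Longrightarrow> x \<in> carr N \<Longrightarrow> y \<in> carr N \<Longrightarrow>
      lact N a (x + y) = lact N a x + lact N a y"
    and lact_add_scalar: "a \<in> scalars N \<Longrightarrow> b \<in> scalars N \<Longrightarrow> x \<in> carr N \<Longrightarrow>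
      lact N (a + b) x = lact N a x + lact N b x"
    and lact_lact: "a \<in> scalars N \<Longrightarrow> b \<in> scalars N \<Longrightarrow> x \<in> carr N \<Longrightarrow>
      lact N a (lact N b x) = lact N (a * b) x"
    and lact_one: "x \<in> carr N \<Longrightarrow> lact N 1 x = x"
    and ract_add: "a \<in> scalars N \<Longrightarrow> x \<in> carr N \<Longrightarrow> y \<in> carr N \<Longrightarrow>
      ract N (x + y) a = ract N x a + ract N y a"
    and lact_ract: "a \<in> scalars N \<Longrightarrow> b \<in> scalars N \<Longrightarrow> x \<in> carr N \<Longrightarrow>
      lact N a (ract N x b) = ract N (lact N a x) b"
begin

lemma scalar_zero [simp]: "0 \<in> scalars N"
  using scalar_add[OF scalar_one scalar_uminus[OF scalar_one]] by simp

lemma lact_zero: "x \<in> carr N \<Longrightarrow> lact N 0 x = 0"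
  using lact_add_scalar[of 0 0 x] by simp

lemma lact_minus_one: "x \<in> carr N \<Longrightarrow> lact N (- 1) x = - x"
  using lact_add_scalar[of "- 1" 1 x] by (simp add: lact_one lact_zero eq_neg_iff_add_eq_0)

lemma uminus_closed [simp]: "x \<in> carr N \<Longrightarrow> - x \<in> carr N"
  by (metis lact_closed lact_minus_one scalar_one scalar_uminus)

lemma diff_closed [simp]: "x \<in> carr N \<Longrightarrow> y \<in> carr N \<Longrightarrow> x - y \<in> carr N"
  using add_closed[of x "- y"] by simp

lemma elem_tensor_zero_left:
  assumes "y \<in> carr N"
  shows "0 \<otimes>\<^bsub>N\<^esub> y = tensor_null N"
proof -
  have "frag_of (0, y) +o tensor_null N = (frag_of (0, y) + frag_of (0, y)) +o tensor_null N"
    using elem_tensor_add_left[of 0 N 0 y] assms by (simp add: elem_tensor_def tensor_coset_add)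
  then have "- frag_of (0, y) \<in> tensor_null N"
    by (simp add: tensor_coset_eq_iff)
  then have "frag_of (0, y) \<in> tensor_null N"
    using tensor_null_uminus by force
  then have "frag_of (0, y) +o tensor_null N = 0 +o tensor_null N"
    by (simp only: tensor_coset_eq_iff diff_zero)
  then show ?thesis
    by (simp add: elem_tensor_def)
qed

text \<open>
  Negatives are absorbed by \<open>- (x \<otimes> y) = (- x) \<otimes> y\<close>, so the elementary tensors generate under
  addition alone.
\<close>

lemma tensor_induct [consumes 1, case_names elem add]:
  assumes t: "t \<in> tensor_space N"
    and elem: "\<And>x y. x \<in> carr N \<Longrightarrow> y \<in> carr N \<Longrightarrow> P (x \<otimes>\<^bsub>N\<^esub> y)"
    and add: "\<And>u v. u \<in> tensor_space N \<Longrightarrow> v \<in> tensor_space N \<Longrightarrow> P u \<Longrightarrow> P v \<Longrightarrow> P (u + v)"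
  shows "P t"
proof -
  obtain c where c: "t = c +o tensor_null N" "Poly_Mapping.keys c \<subseteq> carr N \<times> carr N"
    using t by (auto simp: tensor_space_def)
  let ?Q = "\<lambda>c. P (c +o tensor_null N) \<and> P (- c +o tensor_null N) \<and>
    c +o tensor_null N \<in> tensor_space N \<and> - c +o tensor_null N \<in> tensor_space N"
  have "?Q c"
    using c(2)
  proof (induction c rule: frag_induction)
    case zero
    show ?case
      using elem[of 0 0] elem_tensor_zero_left[of 0] by simp
  next
    case (one p)
    obtain x y where p: "p = (x, y)" "x \<in> carr N" "y \<in> carr N"
      using one by auto
    have "(x + - x) \<otimes>\<^bsub>N\<^esub> y = x \<otimes>\<^bsub>N\<^esub> y + (- x) \<otimes>\<^bsub>N\<^esub> y"
      using p by (intro elem_tensor_add_left) auto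
    then have "0 +o tensor_null N = (frag_of (x, y) + frag_of (- x, y)) +o tensor_null N"
      using elem_tensor_zero_left p by (simp add: elem_tensor_def tensor_coset_add)
    then have "- frag_of (x, y) - frag_of (- x, y) \<in> tensor_null N"
      by (simp only: tensor_coset_eq_iff) (simp add: algebra_simps)
    then have neg: "- frag_of p +o tensor_null N = (- x) \<otimes>\<^bsub>N\<^esub> y"
      by (simp add: elem_tensor_def tensor_coset_eq_iff p)
    have "frag_of p +o tensor_null N = x \<otimes>\<^bsub>N\<^esub> y"
      by (simp add: elem_tensor_def p)
    with neg p show ?case
      by (simp add: elem)
  next
    case (diff c d)
    have "- (c - d) = - c + d" by simp
    then show ?case
      using diff by (simp only: diff_conv_add_uminus minus_add_distrib minus_minus flip: tensor_coset_add)
        (simp add: add tensor_space_add)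
  qed
  then show ?thesis
    by (simp add: c)
qed

lemma tensor_lift_unique:
  assumes add: "\<And>u v. u \<in> tensor_space N \<Longrightarrow> v \<in> tensor_space N \<Longrightarrow> h (u + v) = h u + h v"
    and elem: "\<And>x y. x \<in> carr N \<Longrightarrow> y \<in> carr N \<Longrightarrow> h (x \<otimes>\<^bsub>N\<^esub> y) = s x y"
    and t: "t \<in> tensor_space N"
  shows "tensor_lift N s t = h t"
proof -
  have "tensor_lift N s = restrict h (tensor_space N)"
    unfolding tensor_lift_def
  proof (rule the_equality)
    fix k
    assume k: "k \<in> extensional (tensor_space N) \<and>
     (\<forall>u\<in>tensor_space N. \<forall>v\<in>tensor_space N. k (u + v) = k u + k v) \<and>
     (\<forall>x\<in>carr N. \<forall>y\<in>carr N. k (x \<otimes>\<^bsub>N\<^esub> y) = s x y)"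
    have "k u = h u" if "u \<in> tensor_space N" for u
      using that by (induction rule: tensor_induct) (use k elem add in simp_all)
    then show "k = restrict h (tensor_space N)"
      using k by (auto simp: extensional_def restrict_def)
  qed (auto simp: tensor_space_add add elem)
  then show ?thesis
    using t by simp
qed

lemma tensor_lift_well_defined:
  assumes "\<forall>t\<in>tensor_space N. \<forall>u\<in>tensor_space N. h (t + u) = h t + h u"
    and "\<forall>x\<in>carr N. \<forall>y\<in>carr N. h (x \<otimes>\<^bsub>N\<^esub> y) = s x y"
  shows "t \<in> tensor_space N \<Longrightarrow> u \<in> tensor_space N \<Longrightarrow>
      tensor_lift N s (t + u) = tensor_lift N s t + tensor_lift N s u"
    and "x \<in> carr N \<Longrightarrow> y \<in> carr N \<Longrightarrow> tensor_lift N s (x \<otimes>\<^bsub>N\<^esub> y) = s x y"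
  using tensor_lift_unique[of h s] assms by (auto simp: tensor_space_add)

lemma tensor_lift_cong:
  assumes "\<And>x y. x \<in> carr N \<Longrightarrow> y \<in> carr N \<Longrightarrow> s x y = s' x y"
  shows "tensor_lift N s = tensor_lift N s'"
  unfolding tensor_lift_def using assms by (intro arg_cong[where f = The]) fastforce

text \<open>
  Coefficients act on a ring through \<^term>\<open>of_int\<close>, so the lift to the free abelian group is a
  finite sum.  Functions and 1-forms are rings under pointwise operations, which covers all
  contractions below.
\<close>

lemma tensor_lift_ring:
  fixes s :: "'x \<Rightarrow> 'x \<Rightarrow> 'w::ring_1"
  assumes "biadditive_balanced N s"
  shows tensor_lift_ring_add: "t \<in> tensor_space N \<Longrightarrow> u \<in> tensor_space N \<Longrightarrow>
      tensor_lift N s (t + u) = tensor_lift N s t + tensor_lift N s u"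
    and tensor_lift_ring_elem: "x \<in> carr N \<Longrightarrow> y \<in> carr N \<Longrightarrow> tensor_lift N s (x \<otimes>\<^bsub>N\<^esub> y) = s x y"
proof -
  define H :: "('x \<times> 'x \<Rightarrow>\<^sub>0 int) \<Rightarrow> 'w"
    where "H c = (\<Sum>p\<in>Poly_Mapping.keys c. of_int (Poly_Mapping.lookup c p) * case_prod s p)" for c
  have H_superset: "H c = (\<Sum>p\<in>F. of_int (Poly_Mapping.lookup c p) * case_prod s p)"
    if "finite F" "Poly_Mapping.keys c \<subseteq> F" for c F
    unfolding H_def using that by (intro sum.mono_neutral_left) (auto simp: in_keys_iff)
  have H_add: "H (c + d) = H c + H d" for c d
  proof -
    let ?F = "Poly_Mapping.keys c \<union> Poly_Mapping.keys d"
    have "H c = (\<Sum>p\<in>?F. of_int (Poly_Mapping.lookup c p) * case_prod s p)"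
      "H d = (\<Sum>p\<in>?F. of_int (Poly_Mapping.lookup d p) * case_prod s p)"
      "H (c + d) = (\<Sum>p\<in>?F. of_int (Poly_Mapping.lookup (c + d) p) * case_prod s p)"
      by (rule H_superset; simp add: Poly_Mapping.keys_add)+
    then show ?thesis
      by (simp add: lookup_add distrib_right sum.distrib)
  qed
  have H_zero: "H 0 = 0" by (simp add: H_def)
  have H_diff: "H (c - d) = H c - H d" for c d
    using H_add[of "c - d" d] by simp
  have H_elem: "H (frag_of (x, y)) = s x y" for x y
    by (simp add: H_def)
  have "u \<in> tensor_null N \<Longrightarrow> u \<in> {u. H u = 0}" for u
    by (rule tensor_null_least[rotated -1])
      (use assms in \<open>auto simp: tensor_relators_def biadditive_balanced_def H_diff H_elem H_zero\<close>)
  then obtain h where "\<forall>t\<in>tensor_space N. \<forall>u\<in>tensor_space N. h (t + u) = h t + h u"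
    "\<forall>x\<in>carr N. \<forall>y\<in>carr N. h (x \<otimes>\<^bsub>N\<^esub> y) = s x y"
    using lift_descends[of H N s] H_add H_elem by auto
  note * = tensor_lift_well_defined[OF this]
  show "t \<in> tensor_space N \<Longrightarrow> u \<in> tensor_space N \<Longrightarrow>
      tensor_lift N s (t + u) = tensor_lift N s t + tensor_lift N s u"
    "x \<in> carr N \<Longrightarrow> y \<in> carr N \<Longrightarrow> tensor_lift N s (x \<otimes>\<^bsub>N\<^esub> y) = s x y"
    by (rule *; assumption)+
qed

text \<open>
  When the values are tensors themselves, representatives \<open>r x y\<close> of the cosets \<open>s x y\<close> are extended
  additively; a relator goes into \<open>tensor_null N'\<close> because \<open>s\<close> is balanced.
\<close>

lemma tensor_lift_tensor:
  assumes bal: "biadditive_balanced N s"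
    and target: "\<And>x y. x \<in> carr N \<Longrightarrow> y \<in> carr N \<Longrightarrow> s x y \<in> tensor_space N'"
  shows tensor_lift_tensor_add: "t \<in> tensor_space N \<Longrightarrow> u \<in> tensor_space N \<Longrightarrow>
      tensor_lift N s (t + u) = tensor_lift N s t + tensor_lift N s u"
    and tensor_lift_tensor_elem: "x \<in> carr N \<Longrightarrow> y \<in> carr N \<Longrightarrow> tensor_lift N s (x \<otimes>\<^bsub>N\<^esub> y) = s x y"
    and tensor_lift_tensor_closed: "t \<in> tensor_space N \<Longrightarrow> tensor_lift N s t \<in> tensor_space N'"
proof -
  have "\<forall>x y. \<exists>c. x \<in> carr N \<longrightarrow> y \<in> carr N \<longrightarrow> s x y = c +o tensor_null N'"
    using target by (fastforce simp: tensor_space_def)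
  then obtain r where r: "\<And>x y. x \<in> carr N \<Longrightarrow> y \<in> carr N \<Longrightarrow> s x y = r x y +o tensor_null N'"
    by metis
  define H where "H c = frag_extend (case_prod r) c +o tensor_null N'" for c
  have H_add: "H (c + d) = H c + H d" for c d
    by (simp add: H_def tensor_coset_add frag_extend_add)
  have H_elem: "x \<in> carr N \<Longrightarrow> y \<in> carr N \<Longrightarrow> H (frag_of (x, y)) = s x y" for x y
    by (simp add: H_def r)
  have "u \<in> tensor_null N \<Longrightarrow> u \<in> {u. frag_extend (case_prod r) u \<in> tensor_null N'}" for u
  proof (rule tensor_null_least[rotated -1])
    fix u assume "u \<in> tensor_relators N"
    moreover have "r (x + x') y - (r x y + r x' y) \<in> tensor_null N'"
      if "x \<in> carr N" "x' \<in> carr N" "y \<in> carr N" for x x' y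
      using that bal unfolding tensor_coset_eq_iff[symmetric]
      by (simp add: biadditive_balanced_def tensor_coset_add[symmetric] flip: r)
    moreover have "r x (y + y') - (r x y + r x y') \<in> tensor_null N'"
      if "x \<in> carr N" "y \<in> carr N" "y' \<in> carr N" for x y y'
      using that bal unfolding tensor_coset_eq_iff[symmetric]
      by (simp add: biadditive_balanced_def tensor_coset_add[symmetric] flip: r)
    moreover have "r (ract N x a) y - r x (lact N a y) \<in> tensor_null N'"
      if "x \<in> carr N" "a \<in> scalars N" "y \<in> carr N" for x a y
      using that bal unfolding tensor_coset_eq_iff[symmetric]
      by (simp add: biadditive_balanced_def flip: r)
    ultimately show "u \<in> {u. frag_extend (case_prod r) u \<in> tensor_null N'}"
      by (auto simp: tensor_relators_def frag_extend_diff diff_diff_eq frag_extend_add)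
  qed (auto simp: tensor_null_zero tensor_null_diff frag_extend_diff)
  then have "u \<in> tensor_null N \<Longrightarrow> H (c + u) = H c" for c u
    unfolding H_def tensor_coset_eq_iff by (simp add: frag_extend_add)
  then obtain h where "\<forall>t\<in>tensor_space N. \<forall>u\<in>tensor_space N. h (t + u) = h t + h u"
    "\<forall>x\<in>carr N. \<forall>y\<in>carr N. h (x \<otimes>\<^bsub>N\<^esub> y) = s x y"
    using lift_descends[of H N s] H_add H_elem by metis
  note * = tensor_lift_well_defined[OF this]
  show add: "t \<in> tensor_space N \<Longrightarrow> u \<in> tensor_space N \<Longrightarrow>
      tensor_lift N s (t + u) = tensor_lift N s t + tensor_lift N s u"
    and elem: "x \<in> carr N \<Longrightarrow> y \<in> carr N \<Longrightarrow> tensor_lift N s (x \<otimes>\<^bsub>N\<^esub> y) = s x y" for t u x y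
    by (rule *; assumption)+
  show "t \<in> tensor_space N \<Longrightarrow> tensor_lift N s t \<in> tensor_space N'"
    by (induction rule: tensor_induct) (simp_all add: add elem target tensor_space_add)
qed

lemma lact_elem_balanced:
  "a \<in> scalars N \<Longrightarrow> biadditive_balanced N (\<lambda>x y. lact N a x \<otimes>\<^bsub>N\<^esub> y)"
  by (simp add: biadditive_balanced_def lact_add elem_tensor_add_left elem_tensor_add_right
      lact_ract elem_tensor_balanced)

lemma tensor_lact_elem: "a \<in> scalars N \<Longrightarrow> x \<in> carr N \<Longrightarrow> y \<in> carr N \<Longrightarrow>
    a \<cdot>\<^bsub>N\<^esub> (x \<otimes>\<^bsub>N\<^esub> y) = lact N a x \<otimes>\<^bsub>N\<^esub> y"
  unfolding tensor_lact_def by (rule tensor_lift_tensor_elem[OF lact_elem_balanced, where N' = N]) auto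

lemma tensor_lact_closed [simp]:
  "a \<in> scalars N \<Longrightarrow> t \<in> tensor_space N \<Longrightarrow> (a \<cdot>\<^bsub>N\<^esub> t) \<in> tensor_space N"
  unfolding tensor_lact_def by (rule tensor_lift_tensor_closed[OF lact_elem_balanced, where N' = N]) auto

lemma tensor_lact_add: "a \<in> scalars N \<Longrightarrow> t \<in> tensor_space N \<Longrightarrow> u \<in> tensor_space N \<Longrightarrow>
    a \<cdot>\<^bsub>N\<^esub> (t + u) = (a \<cdot>\<^bsub>N\<^esub> t) + (a \<cdot>\<^bsub>N\<^esub> u)"
  unfolding tensor_lact_def by (rule tensor_lift_tensor_add[OF lact_elem_balanced, where N' = N]) auto

lemma tensor_lact_add_scalar:
  assumes "a \<in> scalars N" "b \<in> scalars N" "t \<in> tensor_space N"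
  shows "(a + b) \<cdot>\<^bsub>N\<^esub> t = (a \<cdot>\<^bsub>N\<^esub> t) + (b \<cdot>\<^bsub>N\<^esub> t)"
  using assms(3)
proof (induction rule: tensor_induct)
  case (elem x y)
  then show ?case
    using assms(1,2) by (simp add: tensor_lact_elem lact_add_scalar elem_tensor_add_left)
next
  case (add u v)
  then show ?case
    using assms(1,2) by (simp add: tensor_lact_add ac_simps)
qed

lemma tensor_lact_lact:
  assumes "a \<in> scalars N" "b \<in> scalars N" "t \<in> tensor_space N"
  shows "a \<cdot>\<^bsub>N\<^esub> (b \<cdot>\<^bsub>N\<^esub> t) = (a * b) \<cdot>\<^bsub>N\<^esub> t"
  using assms(3)
  by (induction rule: tensor_induct)
    (use assms(1,2) in \<open>simp_all add: tensor_lact_elem lact_lact tensor_lact_add\<close>)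

lemma tensor_lact_one: "t \<in> tensor_space N \<Longrightarrow> 1 \<cdot>\<^bsub>N\<^esub> t = t"
  by (induction rule: tensor_induct) (simp_all add: tensor_lact_elem lact_one tensor_lact_add)

lemma tensor_lact_zero: "t \<in> tensor_space N \<Longrightarrow> 0 \<cdot>\<^bsub>N\<^esub> t = tensor_null N"
  by (induction rule: tensor_induct)
    (simp_all add: tensor_lact_elem lact_zero elem_tensor_zero_left tensor_lact_add tensor_null_plus_self)

lemma ract_elem_balanced:
  "a \<in> scalars N \<Longrightarrow> biadditive_balanced N (\<lambda>x y. x \<otimes>\<^bsub>N\<^esub> ract N y a)"
  by (simp add: biadditive_balanced_def ract_add elem_tensor_add_left elem_tensor_add_right
      elem_tensor_balanced flip: lact_ract)

lemma tensor_ract_elem: "a \<in> scalars N \<Longrightarrow> x \<in> carr N \<Longrightarrow> y \<in> carr N \<Longrightarrow>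
    (x \<otimes>\<^bsub>N\<^esub> y) \<bullet>\<^bsub>N\<^esub> a = x \<otimes>\<^bsub>N\<^esub> ract N y a"
  unfolding tensor_ract_def by (rule tensor_lift_tensor_elem[OF ract_elem_balanced, where N' = N]) auto

lemma tensor_ract_closed [simp]:
  "a \<in> scalars N \<Longrightarrow> t \<in> tensor_space N \<Longrightarrow> (t \<bullet>\<^bsub>N\<^esub> a) \<in> tensor_space N"
  unfolding tensor_ract_def by (rule tensor_lift_tensor_closed[OF ract_elem_balanced, where N' = N]) auto

lemma tensor_ract_add: "a \<in> scalars N \<Longrightarrow> t \<in> tensor_space N \<Longrightarrow> u \<in> tensor_space N \<Longrightarrow>
    (t + u) \<bullet>\<^bsub>N\<^esub> a = (t \<bullet>\<^bsub>N\<^esub> a) + (u \<bullet>\<^bsub>N\<^esub> a)"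
  unfolding tensor_ract_def by (rule tensor_lift_tensor_add[OF ract_elem_balanced, where N' = N]) auto

lemma tensor_lact_ract:
  assumes "a \<in> scalars N" "b \<in> scalars N" "t \<in> tensor_space N"
  shows "(a \<cdot>\<^bsub>N\<^esub> t) \<bullet>\<^bsub>N\<^esub> b = a \<cdot>\<^bsub>N\<^esub> (t \<bullet>\<^bsub>N\<^esub> b)"
  using assms(3)
  by (induction rule: tensor_induct)
    (use assms(1,2) in \<open>simp_all add: tensor_lact_elem tensor_ract_elem tensor_lact_add tensor_ract_add\<close>)

text \<open>
  Linearity need only be tested on elementary tensors, since these generate.
\<close>

lemma tensor_bimodule_map_lift:
  assumes bal: "biadditive_balanced N s"
    and closed: "\<And>x y. x \<in> carr N \<Longrightarrow> y \<in> carr N \<Longrightarrow> s x y \<in> tensor_space N"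
    and left: "\<And>a x y. a \<in> scalars N \<Longrightarrow> x \<in> carr N \<Longrightarrow> y \<in> carr N \<Longrightarrow>
      s (lact N a x) y = a \<cdot>\<^bsub>N\<^esub> s x y"
    and right: "\<And>a x y. a \<in> scalars N \<Longrightarrow> x \<in> carr N \<Longrightarrow> y \<in> carr N \<Longrightarrow>
      s x (ract N y a) = s x y \<bullet>\<^bsub>N\<^esub> a"
  shows "tensor_bimodule_map N (tensor_lift N s)"
proof -
  note add = tensor_lift_tensor_add[OF bal closed] and elem = tensor_lift_tensor_elem[OF bal closed]
    and closed' = tensor_lift_tensor_closed[OF bal closed]
  have "tensor_lift N s (a \<cdot>\<^bsub>N\<^esub> t) = a \<cdot>\<^bsub>N\<^esub> tensor_lift N s t"
    "tensor_lift N s (t \<bullet>\<^bsub>N\<^esub> a) = tensor_lift N s t \<bullet>\<^bsub>N\<^esub> a"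
    if "a \<in> scalars N" "t \<in> tensor_space N" for a t
    using that(2)
    by (induction rule: tensor_induct) (use that(1) in \<open>simp_all add: tensor_lact_elem
      tensor_ract_elem tensor_lact_add tensor_ract_add add elem left right closed'\<close>)
  then show ?thesis
    by (simp add: tensor_bimodule_map_def add closed')
qed

lemma elem_tensor_zero_right:
  assumes "x \<in> carr N"
  shows "x \<otimes>\<^bsub>N\<^esub> 0 = tensor_null N"
proof -
  have "frag_of (x, 0) +o tensor_null N = (frag_of (x, 0) + frag_of (x, 0)) +o tensor_null N"
    using elem_tensor_add_right[of x N 0 0] assms by (simp add: elem_tensor_def tensor_coset_add)
  then have "frag_of (x, 0) \<in> tensor_null N"
    using tensor_null_uminus[of "- frag_of (x, 0)" N] by (simp add: tensor_coset_eq_iff)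
  then have "frag_of (x, 0) +o tensor_null N = 0 +o tensor_null N"
    by (simp only: tensor_coset_eq_iff diff_zero)
  then show ?thesis
    by (simp add: elem_tensor_def)
qed

lemma tensor_lact_null: "a \<in> scalars N \<Longrightarrow> a \<cdot>\<^bsub>N\<^esub> tensor_null N = tensor_null N"
  using tensor_lact_lact[of a 0 "tensor_null N"] by (simp add: tensor_lact_zero)

text \<open>
  Addition of cosets is not a group operation on the type of all sets, so terms that cancel
  cannot be removed by ring normalisation.  A computation is therefore carried out with respect
  to a fixed list \<open>ts\<close> of tensors: every term becomes \<open>lincomb ts\<close> of a coefficient list, and equality
  of tensors follows from equality of coefficients in the commutative ring of scalars.
\<close>

primrec lincomb :: "'x tens list \<Rightarrow> 'a list \<Rightarrow> 'x tens" where
  "lincomb [] as = tensor_null N"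
| "lincomb (t # ts) as = (hd as \<cdot>\<^bsub>N\<^esub> t) + lincomb ts (tl as)"

lemma lincomb_closed:
  "set ts \<subseteq> tensor_space N \<Longrightarrow> set as \<subseteq> scalars N \<Longrightarrow> length as = length ts \<Longrightarrow>
    lincomb ts as \<in> tensor_space N"
proof (induction ts arbitrary: as)
  case (Cons t ts)
  then show ?case by (cases as) (auto intro: tensor_space_add)
qed simp

lemma lincomb_add:
  "set ts \<subseteq> tensor_space N \<Longrightarrow> set as \<subseteq> scalars N \<Longrightarrow> set bs \<subseteq> scalars N \<Longrightarrow>
    length as = length ts \<Longrightarrow> length bs = length ts \<Longrightarrow>
    lincomb ts as + lincomb ts bs = lincomb ts (map2 (+) as bs)"
proof (induction ts arbitrary: as bs)
  case (Cons t ts)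
  then obtain a as' b bs' where "as = a # as'" "bs = b # bs'"
    by (cases as; cases bs) auto
  moreover from this Cons.prems have "lincomb ts (map2 (+) as' bs') = lincomb ts as' + lincomb ts bs'"
    by (intro Cons.IH[symmetric]) auto
  ultimately show ?case
    using Cons.prems by (simp add: tensor_lact_add_scalar ac_simps)
qed (simp add: tensor_null_plus_self)

lemma lincomb_lact:
  "set ts \<subseteq> tensor_space N \<Longrightarrow> set as \<subseteq> scalars N \<Longrightarrow> length as = length ts \<Longrightarrow> a \<in> scalars N \<Longrightarrow>
    a \<cdot>\<^bsub>N\<^esub> lincomb ts as = lincomb ts (map ((*) a) as)"
proof (induction ts arbitrary: as)
  case Nil
  then show ?case by (simp add: tensor_lact_null)
next
  case (Cons t ts)
  then obtain b as' where "as = b # as'"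
    by (cases as) auto
  with Cons show ?case
    by (simp add: tensor_lact_add tensor_lact_lact lincomb_closed)
qed

end

section \<open>Vector fields and 1-forms over a function algebra\<close>

text \<open>
  Vector fields and 1-forms are iterated functions.  As rewrite rules the pointwise laws would
  turn a sum of 1-forms into an abstraction that no algebraic law applies to, hence they are
  used only where evaluation is intended.
\<close>

lemmas pointwise = plus_fun_apply zero_fun_apply times_fun_apply one_fun_apply
  minus_apply uminus_apply

declare pointwise [simp del]

lemma fscale_simps:
  shows fscale_add: "fscale f (\<omega> + \<eta>) = fscale f \<omega> + fscale f \<eta>"
    and fscale_add_scalar: "fscale (f + h) \<omega> = fscale f \<omega> + fscale h \<omega>"
    and fscale_mult: "fscale f (fscale h \<omega>) = fscale (f * h) \<omega>"
    and fscale_one: "fscale 1 \<omega> = \<omega>"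
    and fscale_zero: "fscale f 0 = 0" "fscale 0 \<omega> = 0"
  by (simp_all add: fscale_def fun_eq_iff pointwise algebra_simps)

lemma uminus_const: "- (\<lambda>_. c) = (\<lambda>_. - c)"
  by (simp add: fun_eq_iff pointwise)

locale function_algebra =
  fixes C :: "('m \<Rightarrow> 'k::real_normed_field) set"
  assumes const_closed [simp]: "(\<lambda>_. c) \<in> C"
    and add_closed [simp]: "f \<in> C \<Longrightarrow> h \<in> C \<Longrightarrow> f + h \<in> C"
    and mult_closed [simp]: "f \<in> C \<Longrightarrow> h \<in> C \<Longrightarrow> f * h \<in> C"
begin

lemma one_closed [simp]: "1 \<in> C" and zero_closed [simp]: "0 \<in> C"
  using const_closed[of 1] const_closed[of 0] by (simp_all add: one_fun_def zero_fun_def)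

lemma uminus_closed [simp]:
  assumes "f \<in> C"
  shows "- f \<in> C"
proof -
  have "- f = (\<lambda>_. - 1) * f"
    by (simp add: fun_eq_iff pointwise)
  then show ?thesis using assms by simp
qed

lemma vfield_closed [simp]: "X \<in> vector_fields C \<Longrightarrow> f \<in> C \<Longrightarrow> X f \<in> C"
  and vfield_add: "X \<in> vector_fields C \<Longrightarrow> f \<in> C \<Longrightarrow> h \<in> C \<Longrightarrow> X (f + h) = X f + X h"
  and vfield_scale: "X \<in> vector_fields C \<Longrightarrow> f \<in> C \<Longrightarrow> X ((\<lambda>_. c) * f) = (\<lambda>_. c) * X f"
  and vfield_mult: "X \<in> vector_fields C \<Longrightarrow> f \<in> C \<Longrightarrow> h \<in> C \<Longrightarrow> X (f * h) = X f * h + f * X h"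
  by (auto simp: vector_fields_def)

lemma diff_closed [simp]: "f \<in> C \<Longrightarrow> h \<in> C \<Longrightarrow> f - h \<in> C"
  using add_closed[of f "- h"] by simp

lemma vfield_one: "X \<in> vector_fields C \<Longrightarrow> X 1 = 0"
  using vfield_mult[of X 1 1] by simp

lemma vfield_const:
  assumes "X \<in> vector_fields C"
  shows "X (\<lambda>_. c) = 0"
proof -
  have "(\<lambda>_. c) = (\<lambda>_. c) * (1 :: 'm \<Rightarrow> 'k)"
    by (simp add: fun_eq_iff pointwise)
  then have "X (\<lambda>_. c) = (\<lambda>_. c) * X 1"
    using vfield_scale[OF assms one_closed] by metis
  then show ?thesis
    by (simp add: vfield_one[OF assms])
qed

lemma vfield_zero: "X \<in> vector_fields C \<Longrightarrow> X 0 = 0"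
  using vfield_add[of X 0 0] by simp

lemma vfield_outside: "X \<in> vector_fields C \<Longrightarrow> f \<notin> C \<Longrightarrow> X f = 0"
  unfolding vector_fields_def by blast

lemma vector_fieldsI:
  assumes "\<And>f. f \<in> C \<Longrightarrow> X f \<in> C" "\<And>f. f \<notin> C \<Longrightarrow> X f = 0"
    and "\<And>f h. f \<in> C \<Longrightarrow> h \<in> C \<Longrightarrow> X (f + h) = X f + X h"
    and "\<And>c f. f \<in> C \<Longrightarrow> X ((\<lambda>_. c) * f) = (\<lambda>_. c) * X f"
    and "\<And>f h. f \<in> C \<Longrightarrow> h \<in> C \<Longrightarrow> X (f * h) = X f * h + f * X h"
  shows "X \<in> vector_fields C"
  unfolding vector_fields_def using assms by blast

lemma vector_fields_add [simp]:
  assumes "X \<in> vector_fields C" "Y \<in> vector_fields C"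
  shows "X + Y \<in> vector_fields C"
  by (rule vector_fieldsI)
    (use assms in \<open>simp_all add: assms[THEN vfield_outside] assms[THEN vfield_add]
      assms[THEN vfield_const] assms[THEN vfield_mult] pointwise algebra_simps\<close>)

lemma vector_fields_vscale [simp]:
  assumes "f \<in> C" "X \<in> vector_fields C"
  shows "vscale f X \<in> vector_fields C"
  by (rule vector_fieldsI)
    (use assms in \<open>simp_all add: vscale_def vfield_outside[OF assms(2)] vfield_add[OF assms(2)]
      vfield_const[OF assms(2)] vfield_mult[OF assms(2)] pointwise algebra_simps\<close>)

lemma lie_bracket_closed:
  assumes "X \<in> vector_fields C" "Y \<in> vector_fields C"
  shows "lie_bracket X Y \<in> vector_fields C"
  by (rule vector_fieldsI)
    (use assms in \<open>simp_all add: lie_bracket_def assms[THEN vfield_zero]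
      assms[THEN vfield_outside] assms[THEN vfield_add]
      assms[THEN vfield_const] assms[THEN vfield_mult] pointwise algebra_simps\<close>)

lemma form_closed [simp]: "\<omega> \<in> one_forms C \<Longrightarrow> X \<in> vector_fields C \<Longrightarrow> \<omega> X \<in> C"
  and form_outside: "\<omega> \<in> one_forms C \<Longrightarrow> X \<notin> vector_fields C \<Longrightarrow> \<omega> X = 0"
  and form_add: "\<omega> \<in> one_forms C \<Longrightarrow> X \<in> vector_fields C \<Longrightarrow> Y \<in> vector_fields C \<Longrightarrow>
    \<omega> (X + Y) = \<omega> X + \<omega> Y"
  and form_vscale: "\<omega> \<in> one_forms C \<Longrightarrow> f \<in> C \<Longrightarrow> X \<in> vector_fields C \<Longrightarrow>
    \<omega> (vscale f X) = f * \<omega> X"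
  by (auto simp: one_forms_def)

lemma form_eqI:
  assumes "\<omega> \<in> one_forms C" "\<eta> \<in> one_forms C" "\<And>X. X \<in> vector_fields C \<Longrightarrow> \<omega> X = \<eta> X"
  shows "\<omega> = \<eta>"
proof
  fix X show "\<omega> X = \<eta> X"
    using assms by (cases "X \<in> vector_fields C") (auto simp: form_outside)
qed

lemma one_formsI:
  assumes "\<And>X. X \<in> vector_fields C \<Longrightarrow> \<omega> X \<in> C" "\<And>X. X \<notin> vector_fields C \<Longrightarrow> \<omega> X = 0"
    and "\<And>X Y. X \<in> vector_fields C \<Longrightarrow> Y \<in> vector_fields C \<Longrightarrow> \<omega> (X + Y) = \<omega> X + \<omega> Y"
    and "\<And>f X. f \<in> C \<Longrightarrow> X \<in> vector_fields C \<Longrightarrow> \<omega> (vscale f X) = f * \<omega> X"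
  shows "\<omega> \<in> one_forms C"
  unfolding one_forms_def using assms by blast

lemma one_forms_zero [simp]: "0 \<in> one_forms C"
  by (rule one_formsI) (simp_all add: pointwise)

lemma one_forms_add [simp]:
  assumes "\<omega> \<in> one_forms C" "\<eta> \<in> one_forms C"
  shows "\<omega> + \<eta> \<in> one_forms C"
  by (rule one_formsI)
    (use assms in \<open>simp_all add: assms[THEN form_outside] assms[THEN form_add]
      assms[THEN form_vscale] pointwise algebra_simps\<close>)

lemma one_forms_fscale [simp]:
  assumes "f \<in> C" "\<omega> \<in> one_forms C"
  shows "fscale f \<omega> \<in> one_forms C"
  by (rule one_formsI)
    (use assms in \<open>simp_all add: fscale_def form_outside[OF assms(2)] form_add[OF assms(2)]
      form_vscale[OF assms(2)] pointwise algebra_simps\<close>)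

lemma ext_d_apply: "X \<in> vector_fields C \<Longrightarrow> ext_d C f X = X f"
  by (simp add: ext_d_def)

lemma ext_d_closed [simp]:
  assumes "f \<in> C"
  shows "ext_d C f \<in> one_forms C"
  by (rule one_formsI)
    (use assms in \<open>simp_all add: ext_d_apply pointwise fun_eq_iff\<close>, simp_all add: ext_d_def vscale_def pointwise)

lemma ext_d_add:
  assumes "f \<in> C" "h \<in> C"
  shows "ext_d C (f + h) = ext_d C f + ext_d C h"
proof (rule form_eqI)
  fix X assume X: "X \<in> vector_fields C"
  then show "ext_d C (f + h) X = (ext_d C f + ext_d C h) X"
    using assms vfield_add[OF X] by (simp add: ext_d_apply pointwise fun_eq_iff)
qed (use assms in simp_all)

lemma ext_d_mult:
  assumes "f \<in> C" "h \<in> C"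
  shows "ext_d C (f * h) = fscale h (ext_d C f) + fscale f (ext_d C h)"
proof (rule form_eqI)
  fix X assume X: "X \<in> vector_fields C"
  then show "ext_d C (f * h) X = (fscale h (ext_d C f) + fscale f (ext_d C h)) X"
    using assms vfield_mult[OF X] by (simp add: ext_d_apply fscale_def pointwise fun_eq_iff)
qed (use assms in simp_all)

lemma ext_d_const: "ext_d C (\<lambda>_. c) = 0"
proof (rule form_eqI)
  fix X assume X: "X \<in> vector_fields C"
  then show "ext_d C (\<lambda>_. c) X = 0 X"
    using vfield_const[OF X] by (simp add: ext_d_apply pointwise fun_eq_iff)
qed simp_all

lemma ext_d_scale: "f \<in> C \<Longrightarrow> ext_d C ((\<lambda>_. c) * f) = fscale (\<lambda>_. c) (ext_d C f)"
  by (simp add: ext_d_mult ext_d_const fscale_zero)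

lemma ext_d_one: "ext_d C 1 = 0"
  using ext_d_const[of 1] by (simp add: one_fun_def)

lemma ext_d_zero: "ext_d C 0 = 0"
  using ext_d_add[of 0 0] by simp

abbreviation CF :: "('m \<Rightarrow> 'k, ('m, 'k) form) bimod" where
  "CF \<equiv> classical_forms C"

lemma classical_forms_simps [simp]:
  "scalars CF = C" "carr CF = one_forms C" "lact CF = fscale" "ract CF = (\<lambda>\<omega> f. fscale f \<omega>)"
  by (simp_all add: classical_forms_def)

text \<open>
  Both actions on classical 1-forms are multiplication by functions.
\<close>

sublocale cl: bimodule "classical_forms C"
  by unfold_locales (simp_all add: fscale_simps mult.commute)

text \<open>
  Evaluation of the first tensor factor; \<open>contract X (\<nabla>\<omega>)\<close> is \<open>\<nabla>\<^sub>X\<omega>\<close>.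
\<close>

definition contract :: "('m, 'k) vfield \<Rightarrow> ('m, 'k) form tens \<Rightarrow> ('m, 'k) form" where
  "contract X t = tensor_lift CF (\<lambda>\<alpha> \<beta>. fscale (\<alpha> X) \<beta>) t"

lemma contract_balanced: "biadditive_balanced CF (\<lambda>\<alpha> \<beta>. fscale (\<alpha> X) \<beta>)"
  by (simp add: biadditive_balanced_def fscale_add)
    (simp add: fscale_def pointwise fun_eq_iff algebra_simps)

lemma contract_elem: "\<alpha> \<in> one_forms C \<Longrightarrow> \<beta> \<in> one_forms C \<Longrightarrow>
    contract X (\<alpha> \<otimes>\<^bsub>CF\<^esub> \<beta>) = fscale (\<alpha> X) \<beta>"
  unfolding contract_def by (rule cl.tensor_lift_ring_elem[OF contract_balanced]) auto

lemma contract_add: "t \<in> tensor_space CF \<Longrightarrow> u \<in> tensor_space CF \<Longrightarrow>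
    contract X (t + u) = contract X t + contract X u"
  unfolding contract_def by (rule cl.tensor_lift_ring_add[OF contract_balanced]) auto

lemma contract_closed [simp]:
  assumes "X \<in> vector_fields C" "t \<in> tensor_space CF"
  shows "contract X t \<in> one_forms C"
  using assms(2) by (induction rule: cl.tensor_induct)
    (use assms(1) in \<open>simp_all add: contract_elem contract_add\<close>)

lemma contract_lact:
  assumes "f \<in> C" "t \<in> tensor_space CF"
  shows "contract X (f \<cdot>\<^bsub>CF\<^esub> t) = fscale f (contract X t)"
  using assms(2)
proof (induction rule: cl.tensor_induct)
  case (elem \<alpha> \<beta>)
  then show ?case
    using assms(1) by (simp add: contract_elem cl.tensor_lact_elem) (simp add: fscale_def ac_simps)
qed (use assms(1) in \<open>simp_all add: contract_add cl.tensor_lact_add fscale_add\<close>)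

lemma contract_add_field:
  assumes "X \<in> vector_fields C" "Y \<in> vector_fields C" "t \<in> tensor_space CF"
  shows "contract (X + Y) t = contract X t + contract Y t"
  using assms(3) by (induction rule: cl.tensor_induct)
    (use assms(1,2) in \<open>simp_all add: contract_elem contract_add form_add fscale_add_scalar\<close>)

lemma contract_vscale:
  assumes "f \<in> C" "X \<in> vector_fields C" "t \<in> tensor_space CF"
  shows "contract (vscale f X) t = fscale f (contract X t)"
  using assms(3) by (induction rule: cl.tensor_induct)
    (use assms(1,2) in \<open>simp_all add: contract_elem contract_add form_vscale fscale_simps\<close>)

end

locale metric_algebra = function_algebra C
  for C :: "('m \<Rightarrow> 'k::real_normed_field) set" +
  fixes g :: "('m, 'k) vfield \<Rightarrow> ('m, 'k) vfield \<Rightarrow> ('m \<Rightarrow> 'k)"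
    and ip :: "('m, 'k) form \<Rightarrow> ('m, 'k) form \<Rightarrow> ('m \<Rightarrow> 'k)"
  assumes metric: "riemannian_metric C g" and inverse: "inverse_metric C g ip"
begin

abbreviation d :: "('m \<Rightarrow> 'k) \<Rightarrow> ('m, 'k) form" where
  "d \<equiv> ext_d C"

abbreviation sharp :: "('m, 'k) form \<Rightarrow> ('m, 'k) vfield" where
  "sharp \<equiv> dual_field C ip"

text \<open>
  A derivation is determined by its values on functions, so the field that represents \<open>\<omega>\<close> in the
  definition of the inverse metric must be \<open>\<omega>\<^sup>* = (\<omega>, -)\<close>.
\<close>

lemma sharp_represents:
  assumes "\<omega> \<in> one_forms C"
  shows sharp_closed [simp]: "sharp \<omega> \<in> vector_fields C"
    and ip_eq_sharp: "\<eta> \<in> one_forms C \<Longrightarrow> ip \<omega> \<eta> = \<eta> (sharp \<omega>)"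
    and metric_sharp: "Y \<in> vector_fields C \<Longrightarrow> g (sharp \<omega>) Y = \<omega> Y"
proof -
  obtain X where X: "X \<in> vector_fields C" "\<forall>Y\<in>vector_fields C. g X Y = \<omega> Y"
    "\<forall>\<eta>\<in>one_forms C. ip \<omega> \<eta> = \<eta> X"
    using inverse assms unfolding inverse_metric_def by blast
  have "sharp \<omega> = X"
  proof
    fix f show "sharp \<omega> f = X f"
    proof (cases "f \<in> C")
      case True
      then show ?thesis
        using X(3) ext_d_closed[OF True] ext_d_apply[OF X(1)] by (simp add: dual_field_def)
    next
      case False
      then show ?thesis
        using vfield_outside[OF X(1) False] by (simp add: dual_field_def)
    qed
  qed
  with X show "sharp \<omega> \<in> vector_fields C" "\<eta> \<in> one_forms C \<Longrightarrow> ip \<omega> \<eta> = \<eta> (sharp \<omega>)"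
    "Y \<in> vector_fields C \<Longrightarrow> g (sharp \<omega>) Y = \<omega> Y"
    by auto
qed

lemma ip_closed [simp]: "\<omega> \<in> one_forms C \<Longrightarrow> \<eta> \<in> one_forms C \<Longrightarrow> ip \<omega> \<eta> \<in> C"
  by (simp add: ip_eq_sharp)

lemma ip_sym:
  assumes "\<omega> \<in> one_forms C" "\<eta> \<in> one_forms C"
  shows "ip \<omega> \<eta> = ip \<eta> \<omega>"
proof -
  have "ip \<omega> \<eta> = g (sharp \<eta>) (sharp \<omega>)" "ip \<eta> \<omega> = g (sharp \<omega>) (sharp \<eta>)"
    using assms by (simp_all add: ip_eq_sharp metric_sharp)
  then show ?thesis
    using metric assms unfolding riemannian_metric_def by (metis sharp_closed)
qed

lemma ip_add_right: "\<omega> \<in> one_forms C \<Longrightarrow> \<eta> \<in> one_forms C \<Longrightarrow> \<eta>' \<in> one_forms C \<Longrightarrow>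
    ip \<omega> (\<eta> + \<eta>') = ip \<omega> \<eta> + ip \<omega> \<eta>'"
  and ip_fscale_right: "f \<in> C \<Longrightarrow> \<omega> \<in> one_forms C \<Longrightarrow> \<eta> \<in> one_forms C \<Longrightarrow>
    ip \<omega> (fscale f \<eta>) = f * ip \<omega> \<eta>"
  and ip_zero_right: "\<omega> \<in> one_forms C \<Longrightarrow> ip \<omega> 0 = 0"
  by (simp_all add: ip_eq_sharp) (simp_all add: fscale_def pointwise fun_eq_iff)

lemma ip_add_left: "\<omega> \<in> one_forms C \<Longrightarrow> \<omega>' \<in> one_forms C \<Longrightarrow> \<eta> \<in> one_forms C \<Longrightarrow>
    ip (\<omega> + \<omega>') \<eta> = ip \<omega> \<eta> + ip \<omega>' \<eta>"
  using ip_add_right[of \<eta> \<omega> \<omega>'] by (simp add: ip_sym)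

lemma ip_fscale_left: "f \<in> C \<Longrightarrow> \<omega> \<in> one_forms C \<Longrightarrow> \<eta> \<in> one_forms C \<Longrightarrow>
    ip (fscale f \<omega>) \<eta> = f * ip \<omega> \<eta>"
  using ip_fscale_right[of f \<eta> \<omega>] by (simp add: ip_sym)

lemma ip_zero_left: "\<eta> \<in> one_forms C \<Longrightarrow> ip 0 \<eta> = 0"
  using ip_zero_right[of \<eta>] by (simp add: ip_sym)

lemma ip_d: "\<omega> \<in> one_forms C \<Longrightarrow> f \<in> C \<Longrightarrow> ip \<omega> (d f) = sharp \<omega> f"
  by (simp add: dual_field_def)

lemma sharp_add: "\<omega> \<in> one_forms C \<Longrightarrow> \<eta> \<in> one_forms C \<Longrightarrow> sharp (\<omega> + \<eta>) = sharp \<omega> + sharp \<eta>"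
  by (auto simp: pointwise dual_field_def fun_eq_iff ip_add_left)

lemma sharp_fscale: "f \<in> C \<Longrightarrow> \<omega> \<in> one_forms C \<Longrightarrow> sharp (fscale f \<omega>) = vscale f (sharp \<omega>)"
  by (auto simp: pointwise dual_field_def fun_eq_iff ip_fscale_left vscale_def)

end

locale levi_civita_algebra = metric_algebra C g ip
  for C :: "('m \<Rightarrow> 'k::real_normed_field) set" and g ip +
  fixes nb :: "('m, 'k) form \<Rightarrow> ('m, 'k) form tens"
  assumes levi_civita: "levi_civita C ip nb"
begin

abbreviation cov :: "('m, 'k) form \<Rightarrow> ('m, 'k) form \<Rightarrow> ('m, 'k) form" where
  "cov \<equiv> cov_deriv_form C ip nb"

lemma cov_deriv_eq: "cov_deriv C nb X \<omega> = contract X (nb \<omega>)"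
  by (simp add: cov_deriv_def contract_def)

lemma cov_eq: "cov \<omega> \<eta> = contract (sharp \<omega>) (nb \<eta>)"
  by (simp add: cov_deriv_form_def cov_deriv_eq)

lemma nb_closed [simp]: "\<omega> \<in> one_forms C \<Longrightarrow> nb \<omega> \<in> tensor_space CF"
  and nb_add: "\<omega> \<in> one_forms C \<Longrightarrow> \<eta> \<in> one_forms C \<Longrightarrow> nb (\<omega> + \<eta>) = nb \<omega> + nb \<eta>"
  and nb_fscale: "f \<in> C \<Longrightarrow> \<omega> \<in> one_forms C \<Longrightarrow>
    nb (fscale f \<omega>) = d f \<otimes>\<^bsub>CF\<^esub> \<omega> + f \<cdot>\<^bsub>CF\<^esub> nb \<omega>"
  using levi_civita unfolding levi_civita_def left_connection_def classical_forms_simps by blast+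

lemma cov_closed [simp]: "\<omega> \<in> one_forms C \<Longrightarrow> \<eta> \<in> one_forms C \<Longrightarrow> cov \<omega> \<eta> \<in> one_forms C"
  by (simp add: cov_eq)

lemma cov_add_left: "\<omega> \<in> one_forms C \<Longrightarrow> \<omega>' \<in> one_forms C \<Longrightarrow> \<eta> \<in> one_forms C \<Longrightarrow>
    cov (\<omega> + \<omega>') \<eta> = cov \<omega> \<eta> + cov \<omega>' \<eta>"
  by (simp add: cov_eq sharp_add contract_add_field)

lemma cov_fscale_left: "f \<in> C \<Longrightarrow> \<omega> \<in> one_forms C \<Longrightarrow> \<eta> \<in> one_forms C \<Longrightarrow>
    cov (fscale f \<omega>) \<eta> = fscale f (cov \<omega> \<eta>)"
  by (simp add: cov_eq sharp_fscale contract_vscale)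

lemma cov_add_right: "\<omega> \<in> one_forms C \<Longrightarrow> \<eta> \<in> one_forms C \<Longrightarrow> \<eta>' \<in> one_forms C \<Longrightarrow>
    cov \<omega> (\<eta> + \<eta>') = cov \<omega> \<eta> + cov \<omega> \<eta>'"
  by (simp add: cov_eq nb_add contract_add)

lemma cov_leibniz: "f \<in> C \<Longrightarrow> \<omega> \<in> one_forms C \<Longrightarrow> \<eta> \<in> one_forms C \<Longrightarrow>
    cov \<omega> (fscale f \<eta>) = fscale f (cov \<omega> \<eta>) + fscale (ip \<omega> (d f)) \<eta>"
  by (simp add: cov_eq nb_fscale contract_add contract_elem contract_lact ip_d)
    (simp add: ext_d_def add.commute)

lemma cov_zero_left: "\<eta> \<in> one_forms C \<Longrightarrow> cov 0 \<eta> = 0"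
  using cov_add_left[of 0 0 \<eta>] by simp

lemma cov_zero_right: "\<omega> \<in> one_forms C \<Longrightarrow> cov \<omega> 0 = 0"
  using cov_add_right[of \<omega> 0 0] by simp

lemma metric_compatible:
  "X \<in> vector_fields C \<Longrightarrow> \<omega> \<in> one_forms C \<Longrightarrow> \<eta> \<in> one_forms C \<Longrightarrow>
    X (ip \<omega> \<eta>) = ip (contract X (nb \<omega>)) \<eta> + ip \<omega> (contract X (nb \<eta>))"
  using levi_civita unfolding levi_civita_def cov_deriv_eq by blast

text \<open>
  Vanishing torsion, applied to the 1-form \<open>df\<close>: the right-hand side
  \<open>X(Yf) - Y(Xf) - [X,Y]f\<close> is zero.
\<close>

lemma hessian_sym:
  assumes "f \<in> C" "X \<in> vector_fields C" "Y \<in> vector_fields C"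
  shows "contract X (nb (d f)) Y = contract Y (nb (d f)) X"
proof -
  have "lie_bracket X Y \<in> vector_fields C"
    using assms(2,3) by (intro lie_bracket_closed)
  moreover have "contract X (nb (d f)) Y - contract Y (nb (d f)) X
      = X (d f Y) - Y (d f X) - d f (lie_bracket X Y)"
    using levi_civita assms ext_d_closed unfolding levi_civita_def cov_deriv_eq by blast
  ultimately show ?thesis
    using assms by (simp add: ext_d_apply) (simp add: lie_bracket_def pointwise fun_eq_iff)
qed

lemma ip_d_ip:
  assumes "f \<in> C" "\<omega> \<in> one_forms C" "\<eta> \<in> one_forms C"
  shows "ip \<omega> (d (ip \<eta> (d f))) = ip (cov \<omega> \<eta>) (d f) + ip \<eta> (cov \<omega> (d f))"
proof -
  have "ip \<omega> (d (ip \<eta> (d f))) = sharp \<omega> (ip \<eta> (d f))"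
    using assms by (intro ip_d) simp_all
  also have "\<dots> = ip (cov \<omega> \<eta>) (d f) + ip \<eta> (cov \<omega> (d f))"
    using assms by (simp only: cov_eq) (intro metric_compatible, simp_all)
  finally show ?thesis .
qed

lemma ip_cov_d_sym:
  "f \<in> C \<Longrightarrow> \<omega> \<in> one_forms C \<Longrightarrow> \<eta> \<in> one_forms C \<Longrightarrow>
    ip \<eta> (cov \<omega> (d f)) = ip \<omega> (cov \<eta> (d f))"
  by (simp add: ip_eq_sharp cov_eq hessian_sym)

text \<open>
  By the product rule both sides differ by \<open>(\<eta>, \<nabla>\<^sub>\<omega>df) - (\<omega>, \<nabla>\<^sub>\<eta>df)\<close>, which is zero by symmetry of
  the Hessian.  This is \<open>[X,Y] = \<nabla>\<^sub>XY - \<nabla>\<^sub>YX\<close> for the dual fields, applied to \<open>f\<close>.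
\<close>

lemma ip_d_ip_commutator:
  assumes "f \<in> C" "\<omega> \<in> one_forms C" "\<eta> \<in> one_forms C"
  shows "ip \<omega> (d (ip \<eta> (d f))) + ip (cov \<eta> \<omega>) (d f) = ip \<eta> (d (ip \<omega> (d f))) + ip (cov \<omega> \<eta>) (d f)"
  using assms by (simp add: ip_d_ip ip_cov_d_sym[of f \<omega> \<eta>])

text \<open>
  The contraction of the second tensor factor with \<open>df\<close>.
\<close>

definition contract_right :: "('m \<Rightarrow> 'k) \<Rightarrow> ('m, 'k) form tens \<Rightarrow> ('m, 'k) form" where
  "contract_right f t = tensor_lift CF (\<lambda>\<alpha> \<beta>. fscale (ip \<beta> (d f)) \<alpha>) t"

lemma contract_right_balanced:
  "f \<in> C \<Longrightarrow> biadditive_balanced CF (\<lambda>\<alpha> \<beta>. fscale (ip \<beta> (d f)) \<alpha>)"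
  by (simp add: biadditive_balanced_def fscale_simps ip_add_left ip_fscale_left ac_simps)

lemma contract_right_elem: "f \<in> C \<Longrightarrow> \<alpha> \<in> one_forms C \<Longrightarrow> \<beta> \<in> one_forms C \<Longrightarrow>
    contract_right f (\<alpha> \<otimes>\<^bsub>CF\<^esub> \<beta>) = fscale (ip \<beta> (d f)) \<alpha>"
  unfolding contract_right_def by (rule cl.tensor_lift_ring_elem[OF contract_right_balanced]) auto

lemma contract_right_add: "f \<in> C \<Longrightarrow> t \<in> tensor_space CF \<Longrightarrow> u \<in> tensor_space CF \<Longrightarrow>
    contract_right f (t + u) = contract_right f t + contract_right f u"
  unfolding contract_right_def by (rule cl.tensor_lift_ring_add[OF contract_right_balanced]) auto

lemma contract_right_closed [simp]:
  assumes "f \<in> C" "t \<in> tensor_space CF"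
  shows "contract_right f t \<in> one_forms C"
  using assms(2) by (induction rule: cl.tensor_induct)
    (use assms(1) in \<open>simp_all add: contract_right_elem contract_right_add\<close>)

lemma contract_right_apply:
  assumes "f \<in> C" "X \<in> vector_fields C" "t \<in> tensor_space CF"
  shows "contract_right f t X = ip (contract X t) (d f)"
  using assms(3)
proof (induction rule: cl.tensor_induct)
  case (elem \<alpha> \<beta>)
  then show ?case
    using assms(1,2) by (simp add: contract_right_elem contract_elem ip_fscale_left)
      (simp add: fscale_def ac_simps)
next
  case (add u v)
  then show ?case
    using assms(1,2)
    by (simp add: contract_right_add contract_add ip_add_left plus_fun_apply[of "contract_right f u"])
qed

text \<open>
  At a vector field \<open>X\<close> this is \<open>X(\<omega>,df) = (\<nabla>\<^sub>X\<omega>, df) + (\<omega>, \<nabla>\<^sub>Xdf)\<close>, the last term being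
  \<open>(\<nabla>\<^sub>\<omega>df)(X)\<close> by symmetry of the Hessian.
\<close>

lemma d_ip:
  assumes "f \<in> C" "\<omega> \<in> one_forms C"
  shows "d (ip \<omega> (d f)) = contract_right f (nb \<omega>) + cov \<omega> (d f)"
proof (rule form_eqI)
  fix X assume X: "X \<in> vector_fields C"
  have "d (ip \<omega> (d f)) X = ip (contract X (nb \<omega>)) (d f) + ip \<omega> (contract X (nb (d f)))"
    using X assms metric_compatible[of X \<omega> "d f"] by (simp add: ext_d_apply)
  also have "ip \<omega> (contract X (nb (d f))) = cov \<omega> (d f) X"
    using X assms by (simp add: ip_eq_sharp cov_eq hessian_sym)
  finally show "d (ip \<omega> (d f)) X = (contract_right f (nb \<omega>) + cov \<omega> (d f)) X"
    using X assms
      by (simp add: contract_right_apply plus_fun_apply[of "contract_right f (nb \<omega>)"])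
qed (use assms in simp_all)

text \<open>
  The pairing \<open>(t, \<nabla>df)\<close> of a tensor with the Hessian of \<open>f\<close>, in the form in which it occurs in
  commutators: only \<open>\<nabla>\<^sub>\<alpha>df\<close> enters, not a decomposition of \<open>\<nabla>df\<close>.
\<close>

definition hessian_pairing :: "('m \<Rightarrow> 'k) \<Rightarrow> ('m, 'k) form tens \<Rightarrow> ('m \<Rightarrow> 'k)" where
  "hessian_pairing f t = tensor_lift CF (\<lambda>\<alpha> \<beta>. ip \<beta> (cov \<alpha> (d f))) t"

lemma hessian_pairing_balanced:
  "f \<in> C \<Longrightarrow> biadditive_balanced CF (\<lambda>\<alpha> \<beta>. ip \<beta> (cov \<alpha> (d f)))"
  by (simp add: biadditive_balanced_def ip_add_left ip_add_right ip_fscale_left ip_fscale_right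
      cov_add_left cov_fscale_left)

lemma hessian_pairing_elem: "f \<in> C \<Longrightarrow> \<alpha> \<in> one_forms C \<Longrightarrow> \<beta> \<in> one_forms C \<Longrightarrow>
    hessian_pairing f (\<alpha> \<otimes>\<^bsub>CF\<^esub> \<beta>) = ip \<beta> (cov \<alpha> (d f))"
  unfolding hessian_pairing_def by (rule cl.tensor_lift_ring_elem[OF hessian_pairing_balanced]) auto

lemma hessian_pairing_add: "f \<in> C \<Longrightarrow> t \<in> tensor_space CF \<Longrightarrow> u \<in> tensor_space CF \<Longrightarrow>
    hessian_pairing f (t + u) = hessian_pairing f t + hessian_pairing f u"
  unfolding hessian_pairing_def by (rule cl.tensor_lift_ring_add[OF hessian_pairing_balanced]) auto

lemma hessian_pairing_closed [simp]:
  assumes "f \<in> C" "t \<in> tensor_space CF"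
  shows "hessian_pairing f t \<in> C"
  using assms(2) by (induction rule: cl.tensor_induct)
    (use assms(1) in \<open>simp_all add: hessian_pairing_elem hessian_pairing_add\<close>)

lemma tensor_metric_hessian:
  assumes "f \<in> C"
  shows "tensor_metric C ip t (nb (d f)) = hessian_pairing f t"
proof -
  have "tensor_lift CF (\<lambda>\<gamma> \<delta>. ip \<alpha> \<gamma> * ip \<beta> \<delta>) v = ip \<beta> (contract (sharp \<alpha>) v)"
    if "\<alpha> \<in> one_forms C" "\<beta> \<in> one_forms C" "v \<in> tensor_space CF" for \<alpha> \<beta> v
    using that by (intro cl.tensor_lift_unique)
      (simp_all add: contract_add contract_elem ip_add_right ip_fscale_right ip_eq_sharp[of \<alpha>])
  then show ?thesis
    unfolding tensor_metric_def hessian_pairing_def cov_eq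
    using assms by (intro fun_cong[OF cl.tensor_lift_cong]) simp
qed

end

section \<open>The noncommutative bimodule of 1-forms\<close>

lemma emb_simps: "emb (\<alpha> + \<beta>) = emb \<alpha> + emb \<beta>" "emb 0 = 0"
  by (simp_all add: emb_def zero_prod_def)

locale quantum_calculus = levi_civita_algebra C g ip nb
  for C :: "('m \<Rightarrow> 'k::real_normed_field) set" and g ip nb +
  fixes lam :: 'k
begin

abbreviation NF :: "('m \<Rightarrow> 'k, ('m, 'k) ncform) bimod" where
  "NF \<equiv> nc_forms C ip lam"

abbreviation L :: "'m \<Rightarrow> 'k" where
  "L \<equiv> (\<lambda>_. lam)"

abbreviation tensN (infixl "\<otimes>\<^sub>N" 75) where
  "x \<otimes>\<^sub>N y \<equiv> x \<otimes>\<^bsub>NF\<^esub> y"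

abbreviation lactN (infixr "\<cdot>\<^sub>N" 74) where
  "a \<cdot>\<^sub>N t \<equiv> a \<cdot>\<^bsub>NF\<^esub> t"

abbreviation ractN (infixl "\<bullet>\<^sub>N" 73) where
  "t \<bullet>\<^sub>N a \<equiv> t \<bullet>\<^bsub>NF\<^esub> a"

lemma nc_forms_simps [simp]:
  "scalars NF = C" "carr NF = one_forms C \<times> C"
  "lact NF f (\<omega>, h) = (fscale f \<omega>, f * h)"
  "ract NF (\<omega>, h) f = (fscale f \<omega>, h * f + L * ip \<omega> (d f))"
  by (simp_all add: nc_forms_def)

sublocale nc: bimodule "nc_forms C ip lam"
proof unfold_locales
  show "0 \<in> carr NF"
    by (simp add: zero_prod_def)
qed (auto simp: fscale_simps algebra_simps ip_add_left ip_fscale_left)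

lemma emb_closed [simp]: "\<alpha> \<in> one_forms C \<Longrightarrow> emb \<alpha> \<in> one_forms C \<times> C"
  and theta_closed [simp]: "theta \<in> one_forms C \<times> C"
  by (simp_all add: emb_def theta_def)

lemma emb_fscale: "emb (fscale f \<alpha>) = lact NF f (emb \<alpha>)"
  by (simp add: emb_def)

lemma ract_eq:
  assumes "f \<in> C" "x \<in> one_forms C \<times> C"
  shows "ract NF x f = lact NF f x + lact NF (L * ip (fst x) (d f)) theta"
  using assms by (auto simp: theta_def fscale_simps mult.commute)

lemma lact_elem: "f \<in> C \<Longrightarrow> x \<in> one_forms C \<times> C \<Longrightarrow> y \<in> one_forms C \<times> C \<Longrightarrow>
    lact NF f x \<otimes>\<^sub>N y = f \<cdot>\<^sub>N (x \<otimes>\<^sub>N y)"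
  by (simp add: nc.tensor_lact_elem)

text \<open>
  The source of all noncommutativity: moving \<open>f\<close> to the left across \<open>x\<close> uses
  \<open>x \<bullet> f = f x + \<lambda>(x,df) \<theta>'\<close>.
\<close>

lemma elem_lact:
  assumes "f \<in> C" "x \<in> one_forms C \<times> C" "y \<in> one_forms C \<times> C"
  shows "x \<otimes>\<^sub>N lact NF f y = f \<cdot>\<^sub>N (x \<otimes>\<^sub>N y) + (L * ip (fst x) (d f)) \<cdot>\<^sub>N (theta \<otimes>\<^sub>N y)"
proof -
  have fst: "fst x \<in> one_forms C" using assms(2) by auto
  have cl: "lact NF f x \<in> one_forms C \<times> C"
      "lact NF (L * ip (fst x) (d f)) theta \<in> one_forms C \<times> C"
    using assms fst nc.lact_closed by auto
  have "x \<otimes>\<^sub>N lact NF f y = ract NF x f \<otimes>\<^sub>N y"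
    using assms by (intro elem_tensor_balanced[symmetric]) auto
  also have "\<dots> = f \<cdot>\<^sub>N (x \<otimes>\<^sub>N y) + (L * ip (fst x) (d f)) \<cdot>\<^sub>N (theta \<otimes>\<^sub>N y)"
    using assms cl fst by (simp only: ract_eq)
      (simp add: elem_tensor_add_left lact_elem)
  finally show ?thesis .
qed

lemma theta_elem_lact: "f \<in> C \<Longrightarrow> y \<in> one_forms C \<times> C \<Longrightarrow>
    theta \<otimes>\<^sub>N lact NF f y = f \<cdot>\<^sub>N (theta \<otimes>\<^sub>N y)"
  by (subst elem_lact) (simp_all add: theta_def ip_zero_left nc.tensor_lact_zero tensor_null_add_right)

text \<open>
  Here \<open>f\<close> crosses \<open>y\<close>, which leaves a multiple of \<open>\<theta>'\<close>, and then both \<open>f\<close> and the new coefficient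
  cross \<open>x\<close>; hence the term of second order in \<open>\<lambda>\<close>.
\<close>

lemma ract_elem:
  assumes "f \<in> C" "x \<in> one_forms C \<times> C" "y \<in> one_forms C \<times> C"
  shows "(x \<otimes>\<^sub>N y) \<bullet>\<^sub>N f = f \<cdot>\<^sub>N (x \<otimes>\<^sub>N y) + (L * ip (fst x) (d f)) \<cdot>\<^sub>N (theta \<otimes>\<^sub>N y)
    + ((L * ip (fst y) (d f)) \<cdot>\<^sub>N (x \<otimes>\<^sub>N theta)
    + (L * ip (fst x) (d (L * ip (fst y) (d f)))) \<cdot>\<^sub>N (theta \<otimes>\<^sub>N theta))"
proof -
  have fst: "fst x \<in> one_forms C" "fst y \<in> one_forms C" using assms by auto
  have cl: "lact NF f y \<in> one_forms C \<times> C"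
      "lact NF (L * ip (fst y) (d f)) theta \<in> one_forms C \<times> C"
    using assms fst nc.lact_closed by auto
  have "(x \<otimes>\<^sub>N y) \<bullet>\<^sub>N f = x \<otimes>\<^sub>N lact NF f y + x \<otimes>\<^sub>N lact NF (L * ip (fst y) (d f)) theta"
    using assms cl by (simp add: nc.tensor_ract_elem ract_eq elem_tensor_add_right)
  then show ?thesis
    using assms fst by (simp add: elem_lact)
qed

lemma decompose: "x = emb (fst x) + lact NF (snd x) theta"
  by (cases x) (simp add: emb_def theta_def fscale_zero)

lemma theta_elem_decompose: "x \<in> one_forms C \<times> C \<Longrightarrow>
    theta \<otimes>\<^sub>N x = theta \<otimes>\<^sub>N emb (fst x) + snd x \<cdot>\<^sub>N (theta \<otimes>\<^sub>N theta)"
  using nc.lact_closed[of "snd x" theta]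
  by (subst decompose) (auto simp: elem_tensor_add_right theta_elem_lact)

lemma elem_theta_decompose: "x \<in> one_forms C \<times> C \<Longrightarrow>
    x \<otimes>\<^sub>N theta = emb (fst x) \<otimes>\<^sub>N theta + snd x \<cdot>\<^sub>N (theta \<otimes>\<^sub>N theta)"
  using nc.lact_closed[of "snd x" theta]
  by (subst decompose) (auto simp: elem_tensor_add_left lact_elem)

lemma emb_sel [simp]: "fst (emb \<alpha>) = \<alpha>" "snd (emb \<alpha>) = 0"
  and theta_sel [simp]: "fst (theta :: ('m, 'k) ncform) = 0" "snd (theta :: ('m, 'k) ncform) = 1"
  and lact_sel [simp]: "fst (lact NF f x) = fscale f (fst x)" "snd (lact NF f x) = f * snd x"
  and ract_sel [simp]: "fst (ract NF x f) = fscale f (fst x)"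
    "snd (ract NF x f) = snd x * f + L * ip (fst x) (d f)"
  by (simp_all add: emb_def theta_def nc_forms_def split_beta)

lemma tensor_null_add_simps [simp]:
  "t \<in> tensor_space NF \<Longrightarrow> tensor_null NF + t = t"
  "t \<in> tensor_space NF \<Longrightarrow> t + tensor_null NF = t"
  by (simp_all add: tensor_null_add_left tensor_null_add_right)

lemmas tensor_normalize = nc.lincomb_add nc.lincomb_lact nc.tensor_lact_one nc.tensor_lact_zero
  nc.tensor_lact_null nc.elem_tensor_zero_left nc.elem_tensor_zero_right tensor_null_plus_self

section \<open>The lift of covariant derivatives and its commutator with functions\<close>

abbreviation phi_map :: "('m, 'k) form tens \<Rightarrow> ('m, 'k) ncform tens" where
  "phi_map \<equiv> phi C ip nb lam"

definition phi_elem :: "('m, 'k) form \<Rightarrow> ('m, 'k) form \<Rightarrow> ('m, 'k) ncform tens" where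
  "phi_elem \<alpha> \<beta> = emb \<alpha> \<otimes>\<^sub>N emb \<beta> + (- L) \<cdot>\<^sub>N (theta \<otimes>\<^sub>N emb (cov \<alpha> \<beta>))"

lemma phi_map_eq: "phi_map = tensor_lift CF phi_elem"
  by (simp add: phi_def phi_elem_def[abs_def] uminus_const)

lemma phi_elem_closed: "\<alpha> \<in> one_forms C \<Longrightarrow> \<beta> \<in> one_forms C \<Longrightarrow> phi_elem \<alpha> \<beta> \<in> tensor_space NF"
  by (simp add: phi_elem_def tensor_space_add)

text \<open>
  The term \<open>\<lambda>(\<alpha>,df) \<theta>' \<otimes> \<beta>\<close> from moving \<open>f\<close> across \<open>\<alpha>\<close> is cancelled by the Leibniz rule for
  \<open>\<nabla>\<^sub>\<alpha>(f\<beta>)\<close>.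
\<close>

lemma phi_elem_balanced: "biadditive_balanced CF phi_elem"
  unfolding biadditive_balanced_def
proof (intro conjI ballI)
  fix \<alpha> f \<beta> assume "\<alpha> \<in> carr CF" "f \<in> scalars CF" "\<beta> \<in> carr CF"
  then have cl: "\<alpha> \<in> one_forms C" "f \<in> C" "\<beta> \<in> one_forms C"
    by simp_all
  define ts where "ts = [emb \<alpha> \<otimes>\<^sub>N emb \<beta>, theta \<otimes>\<^sub>N emb (cov \<alpha> \<beta>), theta \<otimes>\<^sub>N emb \<beta>]"
  have ts: "set ts \<subseteq> tensor_space NF" "length ts = 3"
    using cl by (auto simp: ts_def)
  have e: "emb \<alpha> \<otimes>\<^sub>N emb \<beta> = nc.lincomb ts [1, 0, 0]"
    "theta \<otimes>\<^sub>N emb (cov \<alpha> \<beta>) = nc.lincomb ts [0, 1, 0]"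
    "theta \<otimes>\<^sub>N emb \<beta> = nc.lincomb ts [0, 0, 1]"
    using cl by (simp_all add: ts_def mem_Times_iff tensor_normalize)
  show "phi_elem (ract CF \<alpha> f) \<beta> = phi_elem \<alpha> (lact CF f \<beta>)"
    using cl ts unfolding phi_elem_def
    by (simp add: mem_Times_iff cov_fscale_left cov_leibniz ip_zero_left emb_simps emb_fscale
      elem_lact lact_elem theta_elem_lact elem_tensor_add_right e tensor_normalize)
qed (simp_all add: phi_elem_def emb_simps elem_tensor_add_left elem_tensor_add_right cov_add_left
  cov_add_right nc.tensor_lact_add ac_simps)

lemma phi_map_elem: "\<alpha> \<in> one_forms C \<Longrightarrow> \<beta> \<in> one_forms C \<Longrightarrow>
    phi_map (\<alpha> \<otimes>\<^bsub>CF\<^esub> \<beta>) = phi_elem \<alpha> \<beta>"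
  unfolding phi_map_eq by (rule cl.tensor_lift_tensor_elem[OF phi_elem_balanced phi_elem_closed]) auto

lemma phi_map_add: "t \<in> tensor_space CF \<Longrightarrow> u \<in> tensor_space CF \<Longrightarrow>
    phi_map (t + u) = phi_map t + phi_map u"
  unfolding phi_map_eq by (rule cl.tensor_lift_tensor_add[OF phi_elem_balanced phi_elem_closed]) auto

lemma phi_map_closed [simp]: "t \<in> tensor_space CF \<Longrightarrow> phi_map t \<in> tensor_space NF"
  unfolding phi_map_eq by (rule cl.tensor_lift_tensor_closed[OF phi_elem_balanced phi_elem_closed]) auto

text \<open>
  The commutator of \<open>\<phi>(\<alpha> \<otimes> \<beta>)\<close> with \<open>f\<close> is
  \<open>\<lambda>(\<alpha>,df) \<theta>' \<otimes> \<beta> + \<lambda>(\<beta>,df) \<alpha> \<otimes> \<theta>' + \<lambda>\<^sup>2((\<alpha>, d(\<beta>,df)) - (\<nabla>\<^sub>\<alpha>\<beta>, df)) \<theta>' \<otimes> \<theta>'\<close>, and the product rule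
  reduces the last coefficient to \<open>\<lambda>\<^sup>2(\<beta>, \<nabla>\<^sub>\<alpha>df)\<close>.  Each term depends on \<open>\<alpha> \<otimes> \<beta>\<close> through a contraction
  and so extends to all tensors.
\<close>

lemma phi_map_ract:
  assumes f: "f \<in> C" and t: "t \<in> tensor_space CF"
  shows "phi_map t \<bullet>\<^sub>N f = f \<cdot>\<^sub>N phi_map t
    + L \<cdot>\<^sub>N (theta \<otimes>\<^sub>N emb (contract (sharp (d f)) t))
    + L \<cdot>\<^sub>N (emb (contract_right f t) \<otimes>\<^sub>N theta)
    + (L * L * hessian_pairing f t) \<cdot>\<^sub>N (theta \<otimes>\<^sub>N theta)"
proof -
  \<comment> \<open>One predicate symbol, since an induction predicate could abstract any of the occurrences of \<open>t\<close>.\<close>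
  define Q where "Q t \<longleftrightarrow> phi_map t \<bullet>\<^sub>N f = f \<cdot>\<^sub>N phi_map t
    + L \<cdot>\<^sub>N (theta \<otimes>\<^sub>N emb (contract (sharp (d f)) t))
    + L \<cdot>\<^sub>N (emb (contract_right f t) \<otimes>\<^sub>N theta)
    + (L * L * hessian_pairing f t) \<cdot>\<^sub>N (theta \<otimes>\<^sub>N theta)" for t
  have "Q t"
    using t
  proof (induction t rule: cl.tensor_induct)
    case (elem \<alpha> \<beta>)
    then have cl: "\<alpha> \<in> one_forms C" "\<beta> \<in> one_forms C"
      by simp_all
    have sharp: "\<alpha> (sharp (d f)) = ip \<alpha> (d f)"
      using f cl by (simp add: ip_eq_sharp[symmetric] ip_sym)
    define ts where "ts = [emb \<alpha> \<otimes>\<^sub>N emb \<beta>, theta \<otimes>\<^sub>N emb (cov \<alpha> \<beta>), theta \<otimes>\<^sub>N emb \<beta>,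
      emb \<alpha> \<otimes>\<^sub>N theta, theta \<otimes>\<^sub>N theta]"
    have ts: "set ts \<subseteq> tensor_space NF" "length ts = 5"
      using cl by (auto simp: ts_def)
    have e: "emb \<alpha> \<otimes>\<^sub>N emb \<beta> = nc.lincomb ts [1, 0, 0, 0, 0]"
      "theta \<otimes>\<^sub>N emb (cov \<alpha> \<beta>) = nc.lincomb ts [0, 1, 0, 0, 0]"
      "theta \<otimes>\<^sub>N emb \<beta> = nc.lincomb ts [0, 0, 1, 0, 0]"
      "emb \<alpha> \<otimes>\<^sub>N theta = nc.lincomb ts [0, 0, 0, 1, 0]"
      "theta \<otimes>\<^sub>N theta = nc.lincomb ts [0, 0, 0, 0, 1]"
      using cl by (simp_all add: ts_def mem_Times_iff tensor_normalize)
    show ?case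
      using f cl ts unfolding Q_def
      apply (simp add: phi_map_elem phi_elem_def contract_elem contract_right_elem hessian_pairing_elem
        sharp emb_fscale lact_elem theta_elem_lact nc.tensor_ract_add nc.tensor_lact_ract ract_elem
        ip_zero_left ext_d_mult ext_d_const fscale_zero ip_fscale_right tensor_normalize mem_Times_iff)
      apply (simp add: e tensor_normalize)
      apply (rule arg_cong[where f = "nc.lincomb ts"], simp add: ip_d_ip algebra_simps)
      done
  next
    case (add t u)
    then show ?case
      using f unfolding Q_def
      by (simp add: phi_map_add contract_add contract_right_add hessian_pairing_add emb_simps
        nc.tensor_ract_add nc.tensor_lact_add nc.tensor_lact_add_scalar elem_tensor_add_left
        elem_tensor_add_right distrib_left ac_simps)
  qed
  then show ?thesis
    by (simp only: Q_def)
qed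

end

section \<open>The generalised braiding\<close>

text \<open>
  The bimodule map property involves only two features of the connection: \<open>T = \<nabla>\<theta>'\<close> commutes with
  functions, and the curvature part \<open>B\<close> of the \<open>\<theta>' \<otimes> \<theta>'\<close> coefficient is bilinear over functions.
\<close>

locale braiding = quantum_calculus C g ip nb lam
  for C :: "('m \<Rightarrow> 'k::real_normed_field) set" and g ip nb lam +
  fixes T :: "('m, 'k) ncform tens"
    and B :: "('m, 'k) form \<Rightarrow> ('m, 'k) form \<Rightarrow> ('m \<Rightarrow> 'k)"
  assumes T_closed [simp]: "T \<in> tensor_space (nc_forms C ip lam)"
    and T_central: "f \<in> C \<Longrightarrow> T \<bullet>\<^bsub>nc_forms C ip lam\<^esub> f = f \<cdot>\<^bsub>nc_forms C ip lam\<^esub> T"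
    and B_closed [simp]: "\<alpha> \<in> one_forms C \<Longrightarrow> \<beta> \<in> one_forms C \<Longrightarrow> B \<alpha> \<beta> \<in> C"
    and B_add_left: "\<alpha> \<in> one_forms C \<Longrightarrow> \<alpha>' \<in> one_forms C \<Longrightarrow> \<beta> \<in> one_forms C \<Longrightarrow>
      B (\<alpha> + \<alpha>') \<beta> = B \<alpha> \<beta> + B \<alpha>' \<beta>"
    and B_add_right: "\<alpha> \<in> one_forms C \<Longrightarrow> \<beta> \<in> one_forms C \<Longrightarrow> \<beta>' \<in> one_forms C \<Longrightarrow>
      B \<alpha> (\<beta> + \<beta>') = B \<alpha> \<beta> + B \<alpha> \<beta>'"
    and B_fscale_left: "f \<in> C \<Longrightarrow> \<alpha> \<in> one_forms C \<Longrightarrow> \<beta> \<in> one_forms C \<Longrightarrow>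
      B (fscale f \<alpha>) \<beta> = f * B \<alpha> \<beta>"
    and B_fscale_right: "f \<in> C \<Longrightarrow> \<alpha> \<in> one_forms C \<Longrightarrow> \<beta> \<in> one_forms C \<Longrightarrow>
      B \<alpha> (fscale f \<beta>) = f * B \<alpha> \<beta>"
begin

lemma B_zero: "\<alpha> \<in> one_forms C \<Longrightarrow> B \<alpha> 0 = 0" "\<alpha> \<in> one_forms C \<Longrightarrow> B 0 \<alpha> = 0"
  using B_add_right[of \<alpha> 0 0] B_add_left[of 0 0 \<alpha>] by simp_all

text \<open>
  The first two terms extend \<open>B\<close> from 1-forms to all of \<open>\<Omega>\<^sup>1\<close>.  They come from writing the products
  \<open>\<omega> \<otimes> k\<theta>'\<close> and \<open>\<eta> \<otimes> h\<theta>'\<close> with the functions on the left; the latter is a part of \<open>y \<otimes> x\<close>.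
\<close>

definition coeff :: "('m, 'k) ncform \<Rightarrow> ('m, 'k) ncform \<Rightarrow> 'm \<Rightarrow> 'k" where
  "coeff x y = L * ip (fst x) (d (snd y)) - L * ip (fst y) (d (snd x)) + B (fst x) (fst y)"

definition braid :: "('m, 'k) ncform \<Rightarrow> ('m, 'k) ncform \<Rightarrow> ('m, 'k) ncform tens" where
  "braid x y = y \<otimes>\<^sub>N x
     + L \<cdot>\<^sub>N (emb (cov (fst x) (fst y)) \<otimes>\<^sub>N theta)
     + (- L) \<cdot>\<^sub>N (theta \<otimes>\<^sub>N emb (cov (fst y) (fst x)))
     + (L * ip (fst x) (fst y)) \<cdot>\<^sub>N T
     + coeff x y \<cdot>\<^sub>N (theta \<otimes>\<^sub>N theta)"

lemma coeff_closed [simp]: "x \<in> one_forms C \<times> C \<Longrightarrow> y \<in> one_forms C \<times> C \<Longrightarrow> coeff x y \<in> C"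
  by (simp add: coeff_def mem_Times_iff)

lemma braid_closed [simp]:
  "x \<in> one_forms C \<times> C \<Longrightarrow> y \<in> one_forms C \<times> C \<Longrightarrow> braid x y \<in> tensor_space NF"
  unfolding braid_def by (intro tensor_space_add nc.tensor_lact_closed elem_tensor_in_space)
    (auto simp: mem_Times_iff)

lemmas bilinear_simps = ip_add_left ip_add_right ip_fscale_left ip_fscale_right ip_zero_left
  ip_zero_right cov_add_left cov_add_right cov_fscale_left cov_leibniz cov_zero_left cov_zero_right
  B_add_left B_add_right B_fscale_left B_fscale_right B_zero ext_d_add ext_d_mult ext_d_one
  ext_d_zero emb_simps emb_fscale

lemma braid_add_left:
  assumes "x \<in> one_forms C \<times> C" "x' \<in> one_forms C \<times> C" "y \<in> one_forms C \<times> C"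
  shows "braid (x + x') y = braid x y + braid x' y"
proof -
  have "coeff (x + x') y = coeff x y + coeff x' y"
    using assms by (simp add: coeff_def bilinear_simps mem_Times_iff algebra_simps)
  then show ?thesis
    using assms unfolding braid_def
    by (simp add: bilinear_simps mem_Times_iff elem_tensor_add_left elem_tensor_add_right
      nc.tensor_lact_add nc.tensor_lact_add_scalar distrib_left ac_simps)
qed

lemma braid_add_right:
  assumes "x \<in> one_forms C \<times> C" "y \<in> one_forms C \<times> C" "y' \<in> one_forms C \<times> C"
  shows "braid x (y + y') = braid x y + braid x y'"
proof -
  have "coeff x (y + y') = coeff x y + coeff x y'"
    using assms by (simp add: coeff_def bilinear_simps mem_Times_iff algebra_simps)
  then show ?thesis
    using assms unfolding braid_def
    by (simp add: bilinear_simps mem_Times_iff elem_tensor_add_left elem_tensor_add_right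
      nc.tensor_lact_add nc.tensor_lact_add_scalar distrib_left ac_simps)
qed

lemma braid_theta_left: "y \<in> one_forms C \<times> C \<Longrightarrow> braid theta y = y \<otimes>\<^sub>N theta"
  by (simp add: braid_def coeff_def bilinear_simps tensor_normalize mem_Times_iff)

lemma braid_theta_right:
  "f \<in> C \<Longrightarrow> x \<in> one_forms C \<times> C \<Longrightarrow> braid x (lact NF f theta) =
    f \<cdot>\<^sub>N (theta \<otimes>\<^sub>N x) + (L * ip (fst x) (d f)) \<cdot>\<^sub>N (theta \<otimes>\<^sub>N theta)"
  by (simp add: braid_def coeff_def bilinear_simps fscale_zero tensor_normalize mem_Times_iff lact_elem)

text \<open>
  Moving \<open>f\<close> across \<open>y\<close> in \<open>y \<otimes> f x\<close> gives \<open>\<lambda>(\<eta>,df) \<theta>' \<otimes> x\<close>.  Its part \<open>\<theta>' \<otimes> \<omega>\<close> cancels against the Leibniz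
  rule for \<open>\<nabla>\<^sub>\<eta>(f\<omega>)\<close>, its part \<open>h \<theta>' \<otimes> \<theta>'\<close> against the one for \<open>d(fh)\<close> in \<open>coeff\<close>.
\<close>

lemma braid_lact_left:
  assumes f: "f \<in> C" and x: "x \<in> one_forms C \<times> C" and y: "y \<in> one_forms C \<times> C"
  shows "braid (lact NF f x) y = f \<cdot>\<^sub>N braid x y"
proof -
  define ts where "ts = [y \<otimes>\<^sub>N x, theta \<otimes>\<^sub>N emb (fst x), emb (cov (fst x) (fst y)) \<otimes>\<^sub>N theta,
    theta \<otimes>\<^sub>N emb (cov (fst y) (fst x)), T, theta \<otimes>\<^sub>N theta]"
  have ts: "set ts \<subseteq> tensor_space NF" "length ts = 6"
    using x y by (auto simp: ts_def mem_Times_iff)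
  have e: "y \<otimes>\<^sub>N x = nc.lincomb ts [1, 0, 0, 0, 0, 0]"
    "theta \<otimes>\<^sub>N emb (fst x) = nc.lincomb ts [0, 1, 0, 0, 0, 0]"
    "emb (cov (fst x) (fst y)) \<otimes>\<^sub>N theta = nc.lincomb ts [0, 0, 1, 0, 0, 0]"
    "theta \<otimes>\<^sub>N emb (cov (fst y) (fst x)) = nc.lincomb ts [0, 0, 0, 1, 0, 0]"
    "T = nc.lincomb ts [0, 0, 0, 0, 1, 0]"
    "theta \<otimes>\<^sub>N theta = nc.lincomb ts [0, 0, 0, 0, 0, 1]"
    using x y by (simp_all add: ts_def mem_Times_iff tensor_normalize)
  show ?thesis
    using f x y ts unfolding braid_def coeff_def
    apply (simp add: mem_Times_iff bilinear_simps elem_lact lact_elem theta_elem_lact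
      elem_tensor_add_right theta_elem_decompose[of x] e tensor_normalize)
    apply (rule arg_cong[where f = "nc.lincomb ts"], simp add: algebra_simps)
    done
qed

text \<open>
  The defect is \<open>\<sigma>(\<lambda>(\<omega>,df) \<theta>' \<otimes> y)\<close>, as \<open>x \<bullet> f = f x + \<lambda>(\<omega>,df) \<theta>'\<close> requires of a balanced map.
\<close>

lemma braid_lact_right:
  assumes f: "f \<in> C" and x: "x \<in> one_forms C \<times> C" and y: "y \<in> one_forms C \<times> C"
  shows "braid x (lact NF f y) = f \<cdot>\<^sub>N braid x y + (L * ip (fst x) (d f)) \<cdot>\<^sub>N (y \<otimes>\<^sub>N theta)"
proof -
  define ts where "ts = [y \<otimes>\<^sub>N x, emb (fst y) \<otimes>\<^sub>N theta, emb (cov (fst x) (fst y)) \<otimes>\<^sub>N theta,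
    theta \<otimes>\<^sub>N emb (cov (fst y) (fst x)), T, theta \<otimes>\<^sub>N theta]"
  have ts: "set ts \<subseteq> tensor_space NF" "length ts = 6"
    using x y by (auto simp: ts_def mem_Times_iff)
  have e: "y \<otimes>\<^sub>N x = nc.lincomb ts [1, 0, 0, 0, 0, 0]"
    "emb (fst y) \<otimes>\<^sub>N theta = nc.lincomb ts [0, 1, 0, 0, 0, 0]"
    "emb (cov (fst x) (fst y)) \<otimes>\<^sub>N theta = nc.lincomb ts [0, 0, 1, 0, 0, 0]"
    "theta \<otimes>\<^sub>N emb (cov (fst y) (fst x)) = nc.lincomb ts [0, 0, 0, 1, 0, 0]"
    "T = nc.lincomb ts [0, 0, 0, 0, 1, 0]"
    "theta \<otimes>\<^sub>N theta = nc.lincomb ts [0, 0, 0, 0, 0, 1]"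
    using x y by (simp_all add: ts_def mem_Times_iff tensor_normalize)
  show ?thesis
    using f x y ts unfolding braid_def coeff_def
    apply (simp add: mem_Times_iff bilinear_simps elem_lact lact_elem theta_elem_lact
      elem_tensor_add_left elem_theta_decompose[of y] e tensor_normalize)
    apply (rule arg_cong[where f = "nc.lincomb ts"], simp add: algebra_simps)
    done
qed

lemma lact_theta_closed: "f \<in> C \<Longrightarrow> lact NF f theta \<in> one_forms C \<times> C"
  by (simp add: mem_Times_iff fscale_zero)

lemma braid_balanced: "biadditive_balanced NF braid"
proof -
  have "braid (ract NF x f) y = braid x (lact NF f y)"
    if "x \<in> one_forms C \<times> C" "f \<in> C" "y \<in> one_forms C \<times> C" for x f y
  proof -
    have u: "L * ip (fst x) (d f) \<in> C"
      using that by (simp add: mem_Times_iff)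
    have "braid (ract NF x f) y = braid (lact NF f x) y + braid (lact NF (L * ip (fst x) (d f)) theta) y"
      using that u nc.lact_closed[of f x] lact_theta_closed[OF u]
      by (simp only: ract_eq) (intro braid_add_left, auto)
    also have "\<dots> = braid x (lact NF f y)"
      using that u by (simp add: braid_lact_left braid_lact_right braid_theta_left)
    finally show ?thesis .
  qed
  then show ?thesis
    unfolding biadditive_balanced_def nc_forms_simps(1,2)
    by (intro conjI ballI braid_add_left braid_add_right) assumption+
qed

text \<open>
  Up to first order in \<open>\<lambda>\<close> both sides agree by the commutation rules.  The difference of the second
  order terms is the identity for \<open>[X,Y]\<close> applied to \<open>f\<close>.
\<close>

lemma braid_ract_right:
  assumes f: "f \<in> C" and x: "x \<in> one_forms C \<times> C" and y: "y \<in> one_forms C \<times> C"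
  shows "braid x (ract NF y f) = braid x y \<bullet>\<^sub>N f"
proof -
  define u where "u = L * ip (fst y) (d f)"
  have u: "u \<in> C"
    using f y by (simp add: u_def mem_Times_iff)
  have "braid x (ract NF y f) = braid x (lact NF f y) + braid x (lact NF u theta)"
    using f x y nc.lact_closed[of f y] lact_theta_closed[OF u]
    by (simp only: ract_eq flip: u_def) (intro braid_add_right, auto)
  also have "\<dots> = f \<cdot>\<^sub>N braid x y + (L * ip (fst x) (d f)) \<cdot>\<^sub>N (y \<otimes>\<^sub>N theta)
      + (u \<cdot>\<^sub>N (theta \<otimes>\<^sub>N x) + (L * ip (fst x) (d u)) \<cdot>\<^sub>N (theta \<otimes>\<^sub>N theta))"
    using f x y u by (simp only: braid_lact_right braid_theta_right)
  also have "\<dots> = braid x y \<bullet>\<^sub>N f"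
  proof -
    have key: "ip (fst x) (d (ip (fst y) (d f))) = ip (fst y) (d (ip (fst x) (d f)))
        + ip (cov (fst x) (fst y)) (d f) - ip (cov (fst y) (fst x)) (d f)"
      using ip_d_ip_commutator[of f "fst x" "fst y"] f x y
      by (simp add: mem_Times_iff algebra_simps)
    define ts where "ts = [y \<otimes>\<^sub>N x, theta \<otimes>\<^sub>N x, y \<otimes>\<^sub>N theta, emb (cov (fst x) (fst y)) \<otimes>\<^sub>N theta,
      theta \<otimes>\<^sub>N emb (cov (fst y) (fst x)), T, theta \<otimes>\<^sub>N theta]"
    have ts: "set ts \<subseteq> tensor_space NF" "length ts = 7"
      using x y by (auto simp: ts_def mem_Times_iff)
    have e: "y \<otimes>\<^sub>N x = nc.lincomb ts [1, 0, 0, 0, 0, 0, 0]"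
      "theta \<otimes>\<^sub>N x = nc.lincomb ts [0, 1, 0, 0, 0, 0, 0]"
      "y \<otimes>\<^sub>N theta = nc.lincomb ts [0, 0, 1, 0, 0, 0, 0]"
      "emb (cov (fst x) (fst y)) \<otimes>\<^sub>N theta = nc.lincomb ts [0, 0, 0, 1, 0, 0, 0]"
      "theta \<otimes>\<^sub>N emb (cov (fst y) (fst x)) = nc.lincomb ts [0, 0, 0, 0, 1, 0, 0]"
      "T = nc.lincomb ts [0, 0, 0, 0, 0, 1, 0]"
      "theta \<otimes>\<^sub>N theta = nc.lincomb ts [0, 0, 0, 0, 0, 0, 1]"
      using x y by (simp_all add: ts_def mem_Times_iff tensor_normalize)
    show ?thesis
      using f x y ts unfolding braid_def coeff_def u_def
      apply (simp add: mem_Times_iff bilinear_simps ext_d_const fscale_zero nc.tensor_ract_add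
        nc.tensor_lact_ract ract_elem T_central tensor_normalize tensor_space_add)
      apply (simp add: e tensor_normalize)
      apply (rule arg_cong[where f = "nc.lincomb ts"], simp add: key algebra_simps)
      done
  qed
  finally show ?thesis .
qed

lemma tensor_bimodule_map_braid: "tensor_bimodule_map NF (tensor_lift NF braid)"
  by (rule nc.tensor_bimodule_map_lift[OF braid_balanced])
    (simp_all only: nc_forms_simps(1,2) braid_closed braid_lact_left braid_ract_right)

lemma tensor_lift_braid: "x \<in> one_forms C \<times> C \<Longrightarrow> y \<in> one_forms C \<times> C \<Longrightarrow>
    tensor_lift NF braid (x \<otimes>\<^sub>N y) = braid x y"
  by (rule nc.tensor_lift_tensor_elem[OF braid_balanced, where N' = NF]) auto

end

section \<open>The connection law\<close>

lemma laplacianD: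
  assumes "laplacian C ip nb D0 D1 Ric"
  shows "f \<in> C \<Longrightarrow> D0 f \<in> C"
    and "f \<in> C \<Longrightarrow> D0 ((\<lambda>_. c) * f) = (\<lambda>_. c) * D0 f"
    and "\<omega> \<in> one_forms C \<Longrightarrow> D1 \<omega> \<in> one_forms C"
    and "\<omega> \<in> one_forms C \<Longrightarrow> \<eta> \<in> one_forms C \<Longrightarrow>
      D0 (ip \<omega> \<eta>) = ip (D1 \<omega>) \<eta> + ip \<omega> (D1 \<eta>) + 2 * tensor_metric C ip (nb \<omega>) (nb \<eta>)"
    and "tensorial C Ric"
    and "f \<in> C \<Longrightarrow> D1 (ext_d C f) = ext_d C (D0 f) + Ric (ext_d C f)"
proof -
  have "f \<in> C \<Longrightarrow> D1 (ext_d C f) - ext_d C (D0 f) = Ric (ext_d C f)"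
    using assms unfolding laplacian_def by blast
  then show "f \<in> C \<Longrightarrow> D1 (ext_d C f) = ext_d C (D0 f) + Ric (ext_d C f)"
    by (metis diff_add_cancel add.commute)
qed (use assms in \<open>unfold laplacian_def, blast+\<close>)

lemma tensorialD:
  assumes "tensorial C K"
  shows "\<omega> \<in> one_forms C \<Longrightarrow> K \<omega> \<in> one_forms C"
    and "\<omega> \<in> one_forms C \<Longrightarrow> \<eta> \<in> one_forms C \<Longrightarrow> K (\<omega> + \<eta>) = K \<omega> + K \<eta>"
    and "f \<in> C \<Longrightarrow> \<omega> \<in> one_forms C \<Longrightarrow> K (fscale f \<omega>) = fscale f (K \<omega>)"
  using assms unfolding tensorial_def by blast+

locale quantum_connection = quantum_calculus C g ip nb lam
  for C :: "('m \<Rightarrow> 'k::real_normed_field) set" and g ip nb lam +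
  fixes D0 :: "('m \<Rightarrow> 'k) \<Rightarrow> ('m \<Rightarrow> 'k)"
    and D1 Ric K :: "('m, 'k) form \<Rightarrow> ('m, 'k) form"
    and nab :: "('m, 'k) ncform \<Rightarrow> ('m, 'k) ncform tens"
  assumes laplacian: "laplacian C ip nb D0 D1 Ric"
    and K: "tensorial C K"
    and connection: "left_connection (nc_forms C ip lam) (nc_d C D0 lam) nab"
    and connection_forms: "\<omega> \<in> one_forms C \<Longrightarrow>
      nab (emb \<omega>) = phi C ip nb lam (nb \<omega>)
        + (\<lambda>_. lam / 2) \<cdot>\<^bsub>nc_forms C ip lam\<^esub> (theta \<otimes>\<^bsub>nc_forms C ip lam\<^esub> emb (D1 \<omega> - K \<omega>))"
    and connection_theta: "f \<in> C \<Longrightarrow>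
      nab theta \<bullet>\<^bsub>nc_forms C ip lam\<^esub> f = f \<cdot>\<^bsub>nc_forms C ip lam\<^esub> nab theta"
begin

abbreviation L2 :: "'m \<Rightarrow> 'k" where
  "L2 \<equiv> (\<lambda>_. lam / 2)"

abbreviation dN :: "('m \<Rightarrow> 'k) \<Rightarrow> ('m, 'k) ncform" where
  "dN \<equiv> nc_d C D0 lam"

lemmas lap = laplacianD[OF laplacian]

lemmas Ric_tensorial = tensorialD[OF lap(5)]

lemmas K_tensorial = tensorialD[OF K]

lemma nab_closed: "x \<in> one_forms C \<times> C \<Longrightarrow> nab x \<in> tensor_space NF"
  and nab_add: "x \<in> one_forms C \<times> C \<Longrightarrow> y \<in> one_forms C \<times> C \<Longrightarrow> nab (x + y) = nab x + nab y"
  and nab_lact: "f \<in> C \<Longrightarrow> x \<in> one_forms C \<times> C \<Longrightarrow>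
    nab (lact NF f x) = dN f \<otimes>\<^sub>N x + f \<cdot>\<^sub>N nab x"
  using connection unfolding left_connection_def nc_forms_simps(1,2) by blast+

definition curvature_term :: "('m, 'k) form \<Rightarrow> ('m, 'k) form \<Rightarrow> 'm \<Rightarrow> 'k" where
  "curvature_term \<omega> \<eta> = (\<lambda>_. lam\<^sup>2 / 2) * (ip \<omega> (Ric \<eta>) + ip \<eta> (K \<omega>))"

sublocale braiding C g ip nb lam "nab theta" curvature_term
proof unfold_locales
  show "nab theta \<in> tensor_space NF"
    by (simp add: nab_closed)
qed (simp_all add: connection_theta curvature_term_def Ric_tensorial K_tensorial ip_add_left
  ip_add_right ip_fscale_left ip_fscale_right algebra_simps)

lemma dN_sel [simp]: "fst (dN f) = d f" "snd (dN f) = L2 * D0 f"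
  by (simp_all add: nc_d_def)

lemma dN_closed: "f \<in> C \<Longrightarrow> dN f \<in> one_forms C \<times> C"
  by (simp add: mem_Times_iff lap(1))

text \<open>
  Since \<open>\<theta>' \<bullet> f = f\<theta>'\<close>, the Leibniz rule gives \<open>df \<otimes> \<theta>' + f\<nabla>\<theta>'\<close>, and \<open>f\<close> may pass to the right of
  \<open>\<nabla>\<theta>'\<close>.
\<close>

lemma nab_ract_theta:
  assumes f: "f \<in> C"
  shows "nab (ract NF theta f) = nab theta \<bullet>\<^sub>N f + braid theta (dN f)"
proof -
  have "ract NF theta f = lact NF f theta"
    using f by (simp add: prod_eq_iff ip_zero_left fscale_zero)
  then show ?thesis
    using f by (simp add: nab_lact connection_theta braid_theta_left dN_closed add.commute)
qed

text \<open>
  Here \<open>\<omega> \<bullet> f = f\<omega> + \<lambda>u\<theta>'\<close> with \<open>u = (\<omega>,df)\<close>, so the left-hand side is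
  \<open>df \<otimes> \<omega> + f\<nabla>\<omega> + d(\<lambda>u) \<otimes> \<theta>' + \<lambda>u\<nabla>\<theta>'\<close> with the noncommutative differential \<open>d\<close>.  By \<open>d_ip\<close> the
  classical part of \<open>d(\<lambda>u)\<close> consists of a contraction of \<open>\<nabla>\<omega>\<close>, which is the one in the commutator
  of \<open>\<phi>(\<nabla>\<omega>)\<close> with \<open>f\<close>, and of \<open>\<nabla>\<^sub>\<omega>df\<close>, which is the one in \<open>\<sigma>(\<omega> \<otimes> df)\<close>.
\<close>

lemma nab_ract_emb:
  assumes f: "f \<in> C" and \<omega>: "\<omega> \<in> one_forms C"
  shows "nab (ract NF (emb \<omega>) f) = nab (emb \<omega>) \<bullet>\<^sub>N f + braid (emb \<omega>) (dN f)"
proof -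
  define D where "D = D1 \<omega> - K \<omega>"
  define u where "u = ip \<omega> (d f)"
  have cl: "D \<in> one_forms C" "u \<in> C" "L * u \<in> C"
    using f \<omega> cl.diff_closed[of "D1 \<omega>" "K \<omega>"] by (simp_all add: D_def u_def lap K_tensorial)
  have "nab (ract NF (emb \<omega>) f) = nab (lact NF f (emb \<omega>)) + nab (lact NF (L * u) theta)"
    using f \<omega> cl nc.lact_closed[of f "emb \<omega>"] lact_theta_closed[OF cl(3)]
    by (simp add: ract_eq flip: u_def) (intro nab_add, auto)
  also have "\<dots> = (dN f \<otimes>\<^sub>N emb \<omega> + f \<cdot>\<^sub>N nab (emb \<omega>))
      + (dN (L * u) \<otimes>\<^sub>N theta + (L * u) \<cdot>\<^sub>N nab theta)"
    using f \<omega> cl by (simp only: nab_lact emb_closed theta_closed)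
  also have "dN (L * u) \<otimes>\<^sub>N theta = L \<cdot>\<^sub>N (emb (contract_right f (nb \<omega>)) \<otimes>\<^sub>N theta)
      + L \<cdot>\<^sub>N (emb (cov \<omega> (d f)) \<otimes>\<^sub>N theta) + (L2 * (L * D0 u)) \<cdot>\<^sub>N (theta \<otimes>\<^sub>N theta)"
  proof -
    have "d (L * u) = fscale L (contract_right f (nb \<omega>)) + fscale L (cov \<omega> (d f))"
      using f \<omega> cl by (simp add: ext_d_scale u_def d_ip fscale_add)
    then show ?thesis
      using f \<omega> cl dN_closed[OF cl(3)]
      by (simp add: elem_theta_decompose[of "dN (L * u)"] emb_simps emb_fscale elem_tensor_add_left lact_elem lap
          mem_Times_iff)
  qed
  finally have lhs: "nab (ract NF (emb \<omega>) f) = (dN f \<otimes>\<^sub>N emb \<omega> + f \<cdot>\<^sub>N nab (emb \<omega>))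
      + (L \<cdot>\<^sub>N (emb (contract_right f (nb \<omega>)) \<otimes>\<^sub>N theta)
      + L \<cdot>\<^sub>N (emb (cov \<omega> (d f)) \<otimes>\<^sub>N theta) + (L2 * (L * D0 u)) \<cdot>\<^sub>N (theta \<otimes>\<^sub>N theta)
      + (L * u) \<cdot>\<^sub>N nab theta)" .
  have D0_u: "D0 u = ip (D1 \<omega>) (d f) + ip \<omega> (d (D0 f)) + ip \<omega> (Ric (d f))
      + 2 * hessian_pairing f (nb \<omega>)"
    using f \<omega> by (simp add: u_def lap tensor_metric_hessian ip_add_right Ric_tensorial algebra_simps)
  have ip_D: "ip (D1 \<omega>) (d f) = ip D (d f) + ip (d f) (K \<omega>)"
  proof -
    have "ip (D1 \<omega>) (d f) = ip (D + K \<omega>) (d f)"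
      by (simp add: D_def)
    also have "\<dots> = ip D (d f) + ip (d f) (K \<omega>)"
      using f \<omega> cl by (simp add: ip_add_left K_tensorial ip_sym[of "K \<omega>"])
    finally show ?thesis .
  qed
  \<comment> \<open>The coefficient of \<open>\<theta>' \<otimes> \<theta>'\<close>, where the conditions on \<open>\<Delta>\<close> and the choice of \<open>\<sigma>\<close> meet.\<close>
  have theta_coeff: "L2 * (L * D0 u) = L * L * hessian_pairing f (nb \<omega>) + L2 * (L * ip D (d f))
      + (L * ip \<omega> (d (L2 * D0 f)) + curvature_term \<omega> (d f))"
  proof -
    have half_square: "(\<lambda>_. lam\<^sup>2 / 2) = L2 * L"
      by (simp add: fun_eq_iff pointwise power2_eq_square)
    have ip_d: "ip \<omega> (d (L2 * D0 f)) = L2 * ip \<omega> (d (D0 f))"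
      using f \<omega> by (simp add: ext_d_scale lap ip_fscale_right)
    have double: "2 * (L2 * h) = L * h" for h
      by (simp add: fun_eq_iff pointwise)
    show ?thesis
      unfolding ip_d curvature_term_def half_square D0_u ip_D
      by (simp add: algebra_simps) (simp add: double)
  qed
  have coeff: "coeff (emb \<omega>) (dN f) = L * ip \<omega> (d (L2 * D0 f)) + curvature_term \<omega> (d f)"
    using f by (simp add: coeff_def ext_d_zero ip_zero_right)
  have contract: "contract (sharp (d f)) (nb \<omega>) = cov (d f) \<omega>"
    by (simp add: cov_eq)
  have nab_emb: "nab (emb \<omega>) = phi_map (nb \<omega>) + L2 \<cdot>\<^sub>N (theta \<otimes>\<^sub>N emb D)"
    using \<omega> by (simp add: connection_forms D_def)
  define ts where "ts = [dN f \<otimes>\<^sub>N emb \<omega>, phi_map (nb \<omega>), theta \<otimes>\<^sub>N emb D,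
    emb (contract_right f (nb \<omega>)) \<otimes>\<^sub>N theta, emb (cov \<omega> (d f)) \<otimes>\<^sub>N theta,
    theta \<otimes>\<^sub>N emb (cov (d f) \<omega>), nab theta, theta \<otimes>\<^sub>N theta]"
  have ts: "set ts \<subseteq> tensor_space NF" "length ts = 8"
    using f \<omega> cl dN_closed[OF f] by (auto simp: ts_def)
  have e: "dN f \<otimes>\<^sub>N emb \<omega> = nc.lincomb ts [1, 0, 0, 0, 0, 0, 0, 0]"
    "phi_map (nb \<omega>) = nc.lincomb ts [0, 1, 0, 0, 0, 0, 0, 0]"
    "theta \<otimes>\<^sub>N emb D = nc.lincomb ts [0, 0, 1, 0, 0, 0, 0, 0]"
    "emb (contract_right f (nb \<omega>)) \<otimes>\<^sub>N theta = nc.lincomb ts [0, 0, 0, 1, 0, 0, 0, 0]"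
    "emb (cov \<omega> (d f)) \<otimes>\<^sub>N theta = nc.lincomb ts [0, 0, 0, 0, 1, 0, 0, 0]"
    "theta \<otimes>\<^sub>N emb (cov (d f) \<omega>) = nc.lincomb ts [0, 0, 0, 0, 0, 1, 0, 0]"
    "nab theta = nc.lincomb ts [0, 0, 0, 0, 0, 0, 1, 0]"
    "theta \<otimes>\<^sub>N theta = nc.lincomb ts [0, 0, 0, 0, 0, 0, 0, 1]"
    using f \<omega> cl dN_closed[OF f] by (simp_all add: ts_def mem_Times_iff tensor_normalize lap)
  show ?thesis
    unfolding lhs
    using f \<omega> cl ts dN_closed[OF f]
    apply (simp add: braid_def coeff nab_emb nc.tensor_ract_add nc.tensor_lact_ract ract_elem
      phi_map_ract contract ip_zero_left ext_d_zero theta_coeff tensor_normalize flip: u_def)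
    apply (simp add: e tensor_normalize lap)
    apply (rule arg_cong[where f = "nc.lincomb ts"], simp add: algebra_simps)
    done
qed

lemma ract_NF_closed: "f \<in> C \<Longrightarrow> x \<in> one_forms C \<times> C \<Longrightarrow> ract NF x f \<in> one_forms C \<times> C"
  using nc.ract_closed by simp

text \<open>
  Both sides are additive in \<open>x\<close>, and replacing \<open>x\<close> by \<open>h x\<close> multiplies both by \<open>h\<close> and adds
  \<open>dh \<otimes> (x \<bullet> f)\<close>; so \<open>x = \<omega> + h\<theta>'\<close> reduces to \<open>\<omega>\<close> and \<open>\<theta>'\<close>.
\<close>

lemma nab_ract:
  assumes f: "f \<in> C" and x: "x \<in> one_forms C \<times> C"
  shows "nab (ract NF x f) = nab x \<bullet>\<^sub>N f + braid x (dN f)"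
proof -
  have add: "nab (ract NF (y + z) f) = nab (y + z) \<bullet>\<^sub>N f + braid (y + z) (dN f)"
    if "y \<in> one_forms C \<times> C" "z \<in> one_forms C \<times> C"
      "nab (ract NF y f) = nab y \<bullet>\<^sub>N f + braid y (dN f)"
      "nab (ract NF z f) = nab z \<bullet>\<^sub>N f + braid z (dN f)" for y z
  proof -
    have "ract NF (y + z) f = ract NF y f + ract NF z f"
      using that f by (intro nc.ract_add) simp_all
    then have "nab (ract NF (y + z) f) = nab (ract NF y f) + nab (ract NF z f)"
      using that(1,2) f by (simp only: nab_add ract_NF_closed)
    then show ?thesis
      using that f dN_closed[OF f]
      by (simp add: nab_add braid_add_left nc.tensor_ract_add nab_closed ac_simps)
  qed
  have scale: "nab (ract NF (lact NF h y) f) = nab (lact NF h y) \<bullet>\<^sub>N f + braid (lact NF h y) (dN f)"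
    if "h \<in> C" "y \<in> one_forms C \<times> C" "nab (ract NF y f) = nab y \<bullet>\<^sub>N f + braid y (dN f)" for h y
  proof -
    have "ract NF (lact NF h y) f = lact NF h (ract NF y f)"
      using that f by (intro nc.lact_ract[symmetric]) simp_all
    then have "nab (ract NF (lact NF h y) f) = dN h \<otimes>\<^sub>N ract NF y f + h \<cdot>\<^sub>N nab (ract NF y f)"
      using that(1,2) f by (simp only: nab_lact ract_NF_closed)
    then show ?thesis
      using that f dN_closed
      by (simp add: nab_lact braid_lact_left nc.tensor_ract_add nc.tensor_lact_add nab_closed
        nc.tensor_ract_elem nc.tensor_lact_ract ac_simps)
  qed
  have cl: "fst x \<in> one_forms C" "snd x \<in> C"
    using x by auto
  have "nab (ract NF (emb (fst x) + lact NF (snd x) theta) f) =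
      nab (emb (fst x) + lact NF (snd x) theta) \<bullet>\<^sub>N f + braid (emb (fst x) + lact NF (snd x) theta) (dN f)"
    using f cl by (intro add scale nab_ract_emb nab_ract_theta emb_closed lact_theta_closed theta_closed)
  then show ?thesis
    by (simp flip: decompose)
qed

lemma bimodule_connection_braid: "bimodule_connection NF dN nab (tensor_lift NF braid)"
  unfolding bimodule_connection_def nc_forms_simps(1,2)
  by (intro conjI ballI connection tensor_bimodule_map_braid)
    (simp only: tensor_lift_braid dN_closed nab_ract)

end

theorem proposition2p4:
  fixes \<A> :: "('m::{second_countable_topology, t2_space}, 'e::euclidean_space) chart set"
    and C :: "('m \<Rightarrow> 'k::real_normed_field) set"
    and g :: "('m, 'k) vfield \<Rightarrow> ('m, 'k) vfield \<Rightarrow> ('m \<Rightarrow> 'k)"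
    and ip :: "('m, 'k) form \<Rightarrow> ('m, 'k) form \<Rightarrow> ('m \<Rightarrow> 'k)"
    and nb :: "('m, 'k) form \<Rightarrow> ('m, 'k) form tens"
    and D0 :: "('m \<Rightarrow> 'k) \<Rightarrow> ('m \<Rightarrow> 'k)"
    and D1 Ric K :: "('m, 'k) form \<Rightarrow> ('m, 'k) form"
    and lam :: 'k
    and N :: "('m \<Rightarrow> 'k, ('m, 'k) ncform) bimod"
    and nab :: "('m, 'k) ncform \<Rightarrow> ('m, 'k) ncform tens"
  assumes manifold: "smooth_atlas \<A>" and C: "C = smooth_functions \<A>"
    and metric: "riemannian_metric C g" "inverse_metric C g ip"
    and levi_civita: "levi_civita C ip nb"
    and laplacian: "laplacian C ip nb D0 D1 Ric"
    and K: "tensorial C K"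
    and N: "N = nc_forms C ip lam"
    and connection: "left_connection N (nc_d C D0 lam) nab"
    and connection_forms: "\<And>\<omega>. \<omega> \<in> one_forms C \<Longrightarrow>
      nab (emb \<omega>) = phi C ip nb lam (nb \<omega>)
        + (\<lambda>_. lam / 2) \<cdot>\<^bsub>N\<^esub> (theta \<otimes>\<^bsub>N\<^esub> emb (D1 \<omega> - K \<omega>))"
    and connection_theta: "\<And>f. f \<in> C \<Longrightarrow> nab theta \<bullet>\<^bsub>N\<^esub> f = f \<cdot>\<^bsub>N\<^esub> nab theta"
  shows "\<exists>\<sigma>. bimodule_connection N (nc_d C D0 lam) nab \<sigma> \<and>
    (\<forall>\<omega>\<in>one_forms C. \<forall>\<eta>\<in>one_forms C.
       \<sigma> (emb \<omega> \<otimes>\<^bsub>N\<^esub> emb \<eta>) =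
         emb \<eta> \<otimes>\<^bsub>N\<^esub> emb \<omega>
         + (\<lambda>_. lam) \<cdot>\<^bsub>N\<^esub> (emb (cov_deriv_form C ip nb \<omega> \<eta>) \<otimes>\<^bsub>N\<^esub> theta)
         + (\<lambda>_. - lam) \<cdot>\<^bsub>N\<^esub> (theta \<otimes>\<^bsub>N\<^esub> emb (cov_deriv_form C ip nb \<eta> \<omega>))
         + ((\<lambda>_. lam) * ip \<omega> \<eta>) \<cdot>\<^bsub>N\<^esub> nab theta
         + ((\<lambda>_. lam\<^sup>2 / 2) * (ip \<omega> (Ric \<eta>) + ip \<eta> (K \<omega>))) \<cdot>\<^bsub>N\<^esub> (theta \<otimes>\<^bsub>N\<^esub> theta)) \<and>
    (\<forall>\<omega>\<in>one_forms C.
       \<sigma> (theta \<otimes>\<^bsub>N\<^esub> emb \<omega>) = emb \<omega> \<otimes>\<^bsub>N\<^esub> theta \<and>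
       \<sigma> (emb \<omega> \<otimes>\<^bsub>N\<^esub> theta) = theta \<otimes>\<^bsub>N\<^esub> emb \<omega>) \<and>
    \<sigma> (theta \<otimes>\<^bsub>N\<^esub> theta) = theta \<otimes>\<^bsub>N\<^esub> theta"
proof -
  interpret quantum_connection C g ip nb lam D0 D1 Ric K nab
  proof unfold_locales
    show "(\<lambda>_. c) \<in> C" for c
      by (simp add: C smooth_functions_const[OF manifold])
    show "f + h \<in> C" if "f \<in> C" "h \<in> C" for f h
      using that by (simp add: C smooth_functions_add[OF manifold])
    show "f * h \<in> C" if "f \<in> C" "h \<in> C" for f h
      using that by (simp add: C smooth_functions_mult[OF manifold])
  qed (use metric levi_civita laplacian K connection connection_forms connection_theta in
    \<open>simp_all add: N\<close>)
  show ?thesis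
    unfolding N
  proof (intro exI[of _ "tensor_lift NF braid"] conjI ballI)
    show "bimodule_connection NF dN nab (tensor_lift NF braid)"
      by (rule bimodule_connection_braid)
  next
    fix \<omega> \<eta> assume forms: "\<omega> \<in> one_forms C" "\<eta> \<in> one_forms C"
    then have "coeff (emb \<omega>) (emb \<eta>) = curvature_term \<omega> \<eta>"
      by (simp add: coeff_def ext_d_zero ip_zero_right)
    with forms show "tensor_lift NF braid (emb \<omega> \<otimes>\<^sub>N emb \<eta>) =
        emb \<eta> \<otimes>\<^sub>N emb \<omega>
        + L \<cdot>\<^sub>N (emb (cov \<omega> \<eta>) \<otimes>\<^sub>N theta)
        + (\<lambda>_. - lam) \<cdot>\<^sub>N (theta \<otimes>\<^sub>N emb (cov \<eta> \<omega>))
        + (L * ip \<omega> \<eta>) \<cdot>\<^sub>N nab theta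
        + ((\<lambda>_. lam\<^sup>2 / 2) * (ip \<omega> (Ric \<eta>) + ip \<eta> (K \<omega>))) \<cdot>\<^sub>N (theta \<otimes>\<^sub>N theta)"
      by (simp add: tensor_lift_braid braid_def curvature_term_def uminus_const)
  next
    fix \<omega> assume "\<omega> \<in> one_forms C"
    then show "tensor_lift NF braid (theta \<otimes>\<^sub>N emb \<omega>) = emb \<omega> \<otimes>\<^sub>N theta"
      "tensor_lift NF braid (emb \<omega> \<otimes>\<^sub>N theta) = theta \<otimes>\<^sub>N emb \<omega>"
      using braid_theta_right[of 1 "emb \<omega>"]
      by (simp_all add: tensor_lift_braid braid_theta_left nc.lact_one ext_d_one ip_zero_right
        tensor_normalize)
  next
    show "tensor_lift NF braid (theta \<otimes>\<^sub>N theta) = theta \<otimes>\<^sub>N theta"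
      by (simp add: tensor_lift_braid braid_theta_left)
  qed
qed

end
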